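(* Let $\mathcal{X},\mathcal{Y},\mathcal{Z}$ be length abelian categories and let $R(\mathcal{Y},\mathcal{X},\mathcal{Z})$ be a recollement of $\mathcal{X}$ relative to $\mathcal{Y}$ and $\mathcal{Z}$, with functors $i^{*},i^{!}:\mathcal{X}\to\mathcal{Y}$, $i_{*}:\mathcal{Y}\to\mathcal{X}$, $j^{*}:\mathcal{X}\to\mathcal{Z}$, $j_{!},j_{*}:\mathcal{Z}\to\mathcal{X}$. Let $\mathcal{W}_{\mathcal{Y}}$ and $\mathcal{W}_{\mathcal{Z}}$ be subcategories of $\mathcal{Y}$ and $\mathcal{Z}$ respectively, and let $$\mathcal{W}_{\mathcal{X}}=\{X\in\mathcal{X}\mid j^{*}X\in\mathcal{W}_{\mathcal{Z}},\ i^{!}X\in\mathcal{W}_{\mathcal{Y}}\}.$$ If $i^{!}$ is exact, then the following are equivalent: (1) $\mathcal{W}_{\mathcal{Y}}$ and $\mathcal{W}_{\mathcal{Z}}$ are wide subcategories (of $\mathcal{Y}$ and $\mathcal{Z}$ respectively). (2) $\mathcal{W}_{\mathcal{X}}$ is a wide subcategory of $\mathcal{X}$.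
   Context: A length abelian category is an abelian category in which every object has finite length. "Subcategory" means a full subcategory closed under isomorphisms and containing the zero object. Recollement: for abelian categories $\mathcal{X},\mathcal{Y},\mathcal{Z}$, a recollement of $\mathcal{X}$ relative to $\mathcal{Y}$ and $\mathcal{Z}$ consists of functors $i^{*},i^{!}:\mathcal{X}\to\mathcal{Y}$, $i_{*}:\mathcal{Y}\to\mathcal{X}$, $j^{*}:\mathcal{X}\to\mathcal{Z}$, $j_{!},j_{*}:\mathcal{Z}\to\mathcal{X}$ such that: (a) $(i^{*},i_{*})$, $(i_{*},i^{!})$, $(j_{!},j^{*})$, $(j^{*},j_{*})$ are adjoint pairs (left adjoint written first); (b) $i_{*},j_{!},j_{*}$ are fully faithful; (c) $\operatorname{Im} i_{*}=\operatorname{Ker} j^{*}$ (the essential image of $i_*$ is the full subcategory of objects $X$ with $j^{*}X=0$). A subcategory $\mathcal{E}$ of a length abelian category $\mathcal{A}$ is wide if it is closed under extensions (for every short exact sequence $0\to X\to Y\to Z\to 0$ in $\mathcal{A}$ with $X,Z\in\mathcal{E}$ one has $Y\in\mathcal{E}$), kernels and cokernels (for every morphism $f$ in $\mathcal{E}$, $\operatorname{Ker} f$ and $\operatorname{Coker} f$, computed in $\mathcal{A}$, belong to $\mathcal{E}$). *)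

theory Defs
  imports "HOL-Algebra.Group"
begin

section \<open>Categories and functors\<close>

record ('o, 'm) cat =
  Obj :: "'o set"
  Arr :: "'m set"
  Dom :: "'m \<Rightarrow> 'o"
  Cod :: "'m \<Rightarrow> 'o"
  Id :: "'o \<Rightarrow> 'm"
  Comp :: "'m \<Rightarrow> 'm \<Rightarrow> 'm"  (infixr "\<cdot>\<index>" 70)  \<comment> \<open>\<open>g \<cdot> f\<close> is \<open>f\<close> followed by \<open>g\<close>\<close>

definition Hom :: "('o, 'm, 'e) cat_scheme \<Rightarrow> 'o \<Rightarrow> 'o \<Rightarrow> 'm set" where
  "Hom C A B = {f \<in> Arr C. Dom C f = A \<and> Cod C f = B}"

locale category =
  fixes C :: "('o, 'm, 'e) cat_scheme" (structure)
  assumes dom_obj: "f \<in> Arr C \<Longrightarrow> Dom C f \<in> Obj C"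
    and cod_obj: "f \<in> Arr C \<Longrightarrow> Cod C f \<in> Obj C"
    and id_hom: "A \<in> Obj C \<Longrightarrow> Id C A \<in> Hom C A A"
    and comp_hom: "\<lbrakk>f \<in> Hom C A B; g \<in> Hom C B D\<rbrakk> \<Longrightarrow> g \<cdot> f \<in> Hom C A D"
    and comp_id_right: "f \<in> Hom C A B \<Longrightarrow> f \<cdot> Id C A = f"
    and comp_id_left: "f \<in> Hom C A B \<Longrightarrow> Id C B \<cdot> f = f"
    and comp_assoc:
      "\<lbrakk>f \<in> Hom C A B; g \<in> Hom C B D; h \<in> Hom C D E\<rbrakk> \<Longrightarrow> (h \<cdot> g) \<cdot> f = h \<cdot> (g \<cdot> f)"

definition is_iso :: "('o, 'm, 'e) cat_scheme \<Rightarrow> 'm \<Rightarrow> bool" where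
  "is_iso C f \<longleftrightarrow> f \<in> Arr C \<and>
    (\<exists>g \<in> Hom C (Cod C f) (Dom C f).
       g \<cdot>\<^bsub>C\<^esub> f = Id C (Dom C f) \<and> f \<cdot>\<^bsub>C\<^esub> g = Id C (Cod C f))"

definition isomorphic :: "('o, 'm, 'e) cat_scheme \<Rightarrow> 'o \<Rightarrow> 'o \<Rightarrow> bool" where
  "isomorphic C A B \<longleftrightarrow> (\<exists>f \<in> Hom C A B. is_iso C f)"

definition is_mono :: "('o, 'm, 'e) cat_scheme \<Rightarrow> 'm \<Rightarrow> bool" where
  "is_mono C f \<longleftrightarrow> f \<in> Arr C \<and>
    (\<forall>T \<in> Obj C. \<forall>s \<in> Hom C T (Dom C f). \<forall>t \<in> Hom C T (Dom C f).
       f \<cdot>\<^bsub>C\<^esub> s = f \<cdot>\<^bsub>C\<^esub> t \<longrightarrow> s = t)"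

definition is_epi :: "('o, 'm, 'e) cat_scheme \<Rightarrow> 'm \<Rightarrow> bool" where
  "is_epi C f \<longleftrightarrow> f \<in> Arr C \<and>
    (\<forall>T \<in> Obj C. \<forall>s \<in> Hom C (Cod C f) T. \<forall>t \<in> Hom C (Cod C f) T.
       s \<cdot>\<^bsub>C\<^esub> f = t \<cdot>\<^bsub>C\<^esub> f \<longrightarrow> s = t)"

definition is_zero_obj :: "('o, 'm, 'e) cat_scheme \<Rightarrow> 'o \<Rightarrow> bool" where
  "is_zero_obj C Z \<longleftrightarrow> Z \<in> Obj C \<and>
    (\<forall>A \<in> Obj C. (\<exists>!f. f \<in> Hom C A Z) \<and> (\<exists>!f. f \<in> Hom C Z A))"

record ('o1, 'm1, 'o2, 'm2) funct =
  on_obj :: "'o1 \<Rightarrow> 'o2"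
  on_arr :: "'m1 \<Rightarrow> 'm2"

definition is_functor ::
  "('o1, 'm1, 'e1) cat_scheme \<Rightarrow> ('o2, 'm2, 'e2) cat_scheme \<Rightarrow> ('o1, 'm1, 'o2, 'm2) funct \<Rightarrow> bool"
where
  "is_functor C D F \<longleftrightarrow>
    (\<forall>A \<in> Obj C. on_obj F A \<in> Obj D) \<and>
    (\<forall>A \<in> Obj C. \<forall>B \<in> Obj C. \<forall>f \<in> Hom C A B. on_arr F f \<in> Hom D (on_obj F A) (on_obj F B)) \<and>
    (\<forall>A \<in> Obj C. on_arr F (Id C A) = Id D (on_obj F A)) \<and>
    (\<forall>f \<in> Arr C. \<forall>g \<in> Arr C. Cod C f = Dom C g \<longrightarrow>
       on_arr F (g \<cdot>\<^bsub>C\<^esub> f) = on_arr F g \<cdot>\<^bsub>D\<^esub> on_arr F f)"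

definition fully_faithful ::
  "('o1, 'm1, 'e1) cat_scheme \<Rightarrow> ('o2, 'm2, 'e2) cat_scheme \<Rightarrow> ('o1, 'm1, 'o2, 'm2) funct \<Rightarrow> bool"
where
  "fully_faithful C D F \<longleftrightarrow>
    (\<forall>A \<in> Obj C. \<forall>B \<in> Obj C.
       bij_betw (on_arr F) (Hom C A B) (Hom D (on_obj F A) (on_obj F B)))"

text \<open>\<open>F : C \<rightarrow> D\<close> is left adjoint to \<open>G : D \<rightarrow> C\<close>; the two equations are naturality of
  \<open>\<phi> A B : Hom (F A) B \<rightarrow> Hom A (G B)\<close> in \<open>A\<close> and in \<open>B\<close>.\<close>

definition adjoint_pair ::
  "('o1, 'm1, 'e1) cat_scheme \<Rightarrow> ('o2, 'm2, 'e2) cat_scheme \<Rightarrow>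
   ('o1, 'm1, 'o2, 'm2) funct \<Rightarrow> ('o2, 'm2, 'o1, 'm1) funct \<Rightarrow> bool"
where
  "adjoint_pair C D F G \<longleftrightarrow>
    (\<exists>\<phi>. (\<forall>A \<in> Obj C. \<forall>B \<in> Obj D.
            bij_betw (\<phi> A B) (Hom D (on_obj F A) B) (Hom C A (on_obj G B))) \<and>
         (\<forall>A \<in> Obj C. \<forall>A' \<in> Obj C. \<forall>B \<in> Obj D.
            \<forall>a \<in> Hom C A' A. \<forall>h \<in> Hom D (on_obj F A) B.
              \<phi> A' B (h \<cdot>\<^bsub>D\<^esub> on_arr F a) = \<phi> A B h \<cdot>\<^bsub>C\<^esub> a) \<and>
         (\<forall>A \<in> Obj C. \<forall>B \<in> Obj D. \<forall>B' \<in> Obj D.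
            \<forall>b \<in> Hom D B B'. \<forall>h \<in> Hom D (on_obj F A) B.
              \<phi> A B' (b \<cdot>\<^bsub>D\<^esub> h) = on_arr G b \<cdot>\<^bsub>C\<^esub> \<phi> A B h))"

section \<open>Abelian categories\<close>

record ('o, 'm) acat = "('o, 'm) cat" +
  Zero :: "'o \<Rightarrow> 'o \<Rightarrow> 'm"
  Add :: "'m \<Rightarrow> 'm \<Rightarrow> 'm"  (infixl "\<boxplus>\<index>" 65)

definition Hom_group :: "('o, 'm, 'e) acat_scheme \<Rightarrow> 'o \<Rightarrow> 'o \<Rightarrow> 'm monoid" where
  "Hom_group C A B = \<lparr>carrier = Hom C A B, mult = Add C, one = Zero C A B\<rparr>"

locale preadditive_category = category C
  for C :: "('o, 'm, 'e) acat_scheme" (structure) +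
  assumes hom_group: "\<lbrakk>A \<in> Obj C; B \<in> Obj C\<rbrakk> \<Longrightarrow> comm_group (Hom_group C A B)"
    and comp_add_left:
      "\<lbrakk>f \<in> Hom C A B; g \<in> Hom C B D; h \<in> Hom C B D\<rbrakk> \<Longrightarrow> (g \<boxplus> h) \<cdot> f = (g \<cdot> f) \<boxplus> (h \<cdot> f)"
    and comp_add_right:
      "\<lbrakk>f \<in> Hom C A B; g \<in> Hom C A B; h \<in> Hom C B D\<rbrakk> \<Longrightarrow> h \<cdot> (f \<boxplus> g) = (h \<cdot> f) \<boxplus> (h \<cdot> g)"

definition is_biproduct ::
  "('o, 'm, 'e) acat_scheme \<Rightarrow> 'o \<Rightarrow> 'o \<Rightarrow> 'o \<Rightarrow> 'm \<Rightarrow> 'm \<Rightarrow> 'm \<Rightarrow> 'm \<Rightarrow> bool" where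
  "is_biproduct C A B P i\<^sub>1 i\<^sub>2 p\<^sub>1 p\<^sub>2 \<longleftrightarrow> P \<in> Obj C \<and>
    i\<^sub>1 \<in> Hom C A P \<and> i\<^sub>2 \<in> Hom C B P \<and> p\<^sub>1 \<in> Hom C P A \<and> p\<^sub>2 \<in> Hom C P B \<and>
    p\<^sub>1 \<cdot>\<^bsub>C\<^esub> i\<^sub>1 = Id C A \<and> p\<^sub>2 \<cdot>\<^bsub>C\<^esub> i\<^sub>2 = Id C B \<and>
    p\<^sub>1 \<cdot>\<^bsub>C\<^esub> i\<^sub>2 = Zero C B A \<and> p\<^sub>2 \<cdot>\<^bsub>C\<^esub> i\<^sub>1 = Zero C A B \<and>
    (i\<^sub>1 \<cdot>\<^bsub>C\<^esub> p\<^sub>1) \<boxplus>\<^bsub>C\<^esub> (i\<^sub>2 \<cdot>\<^bsub>C\<^esub> p\<^sub>2) = Id C P"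

definition is_kernel :: "('o, 'm, 'e) acat_scheme \<Rightarrow> 'm \<Rightarrow> 'm \<Rightarrow> bool" where
  "is_kernel C f k \<longleftrightarrow> f \<in> Arr C \<and> k \<in> Arr C \<and> Cod C k = Dom C f \<and>
    f \<cdot>\<^bsub>C\<^esub> k = Zero C (Dom C k) (Cod C f) \<and>
    (\<forall>T \<in> Obj C. \<forall>t \<in> Hom C T (Dom C f).
       f \<cdot>\<^bsub>C\<^esub> t = Zero C T (Cod C f) \<longrightarrow> (\<exists>!u. u \<in> Hom C T (Dom C k) \<and> k \<cdot>\<^bsub>C\<^esub> u = t))"

definition is_cokernel :: "('o, 'm, 'e) acat_scheme \<Rightarrow> 'm \<Rightarrow> 'm \<Rightarrow> bool" where
  "is_cokernel C f q \<longleftrightarrow> f \<in> Arr C \<and> q \<in> Arr C \<and> Dom C q = Cod C f \<and>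
    q \<cdot>\<^bsub>C\<^esub> f = Zero C (Dom C f) (Cod C q) \<and>
    (\<forall>T \<in> Obj C. \<forall>t \<in> Hom C (Cod C f) T.
       t \<cdot>\<^bsub>C\<^esub> f = Zero C (Dom C f) T \<longrightarrow> (\<exists>!u. u \<in> Hom C (Cod C q) T \<and> u \<cdot>\<^bsub>C\<^esub> q = t))"

locale abelian_category = preadditive_category +
  assumes ex_zero_obj: "\<exists>Z. is_zero_obj C Z"
    and ex_biproduct:
      "\<lbrakk>A \<in> Obj C; B \<in> Obj C\<rbrakk> \<Longrightarrow> \<exists>P i\<^sub>1 i\<^sub>2 p\<^sub>1 p\<^sub>2. is_biproduct C A B P i\<^sub>1 i\<^sub>2 p\<^sub>1 p\<^sub>2"
    and ex_kernel: "f \<in> Arr C \<Longrightarrow> \<exists>k. is_kernel C f k"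
    and ex_cokernel: "f \<in> Arr C \<Longrightarrow> \<exists>q. is_cokernel C f q"
    and mono_is_kernel: "is_mono C m \<Longrightarrow> \<exists>f. is_kernel C f m"
    and epi_is_cokernel: "is_epi C e \<Longrightarrow> \<exists>f. is_cokernel C f e"

text \<open>\<open>0 \<rightarrow> Dom f \<rightarrow> Cod f = Dom g \<rightarrow> Cod g \<rightarrow> 0\<close>.\<close>

definition short_exact :: "('o, 'm, 'e) acat_scheme \<Rightarrow> 'm \<Rightarrow> 'm \<Rightarrow> bool" where
  "short_exact C f g \<longleftrightarrow> is_kernel C g f \<and> is_cokernel C f g"

definition exact_functor ::
  "('o1, 'm1, 'e1) acat_scheme \<Rightarrow> ('o2, 'm2, 'e2) acat_scheme \<Rightarrow> ('o1, 'm1, 'o2, 'm2) funct \<Rightarrow> bool"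
where
  "exact_functor C D F \<longleftrightarrow> is_functor C D F \<and>
    (\<forall>f g. short_exact C f g \<longrightarrow> short_exact D (on_arr F f) (on_arr F g))"

definition is_simple :: "('o, 'm, 'e) acat_scheme \<Rightarrow> 'o \<Rightarrow> bool" where
  "is_simple C S \<longleftrightarrow> S \<in> Obj C \<and> \<not> is_zero_obj C S \<and>
    (\<forall>m. is_mono C m \<and> Cod C m = S \<longrightarrow> is_zero_obj C (Dom C m) \<or> is_iso C m)"

text \<open>Existence of a composition series
  \<open>0 = F 0 \<rightarrow> F 1 \<rightarrow> \<dots> \<rightarrow> F n = X\<close> with simple quotients \<open>Cod (q i)\<close>.\<close>

definition finite_length :: "('o, 'm, 'e) acat_scheme \<Rightarrow> 'o \<Rightarrow> bool" where
  "finite_length C X \<longleftrightarrow>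
    (\<exists>(n :: nat) F m q. is_zero_obj C (F 0) \<and> F n = X \<and>
       (\<forall>i < n. m i \<in> Hom C (F i) (F (Suc i)) \<and>
          short_exact C (m i) (q i) \<and> is_simple C (Cod C (q i))))"

locale length_abelian_category = abelian_category +
  assumes obj_finite_length: "X \<in> Obj C \<Longrightarrow> finite_length C X"

section \<open>Subcategories\<close>

text \<open>Full subcategories are given by their sets of objects.\<close>

definition subcategory :: "('o, 'm, 'e) cat_scheme \<Rightarrow> 'o set \<Rightarrow> bool" where
  "subcategory C W \<longleftrightarrow> W \<subseteq> Obj C \<and>
    (\<forall>A \<in> W. \<forall>B \<in> Obj C. isomorphic C A B \<longrightarrow> B \<in> W) \<and>
    (\<exists>Z \<in> W. is_zero_obj C Z)"

definition wide_subcategory :: "('o, 'm, 'e) acat_scheme \<Rightarrow> 'o set \<Rightarrow> bool" where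
  "wide_subcategory C W \<longleftrightarrow> subcategory C W \<and>
    (\<forall>f g. short_exact C f g \<and> Dom C f \<in> W \<and> Cod C g \<in> W \<longrightarrow> Cod C f \<in> W) \<and>
    (\<forall>A \<in> W. \<forall>B \<in> W. \<forall>f \<in> Hom C A B. \<forall>k. is_kernel C f k \<longrightarrow> Dom C k \<in> W) \<and>
    (\<forall>A \<in> W. \<forall>B \<in> W. \<forall>f \<in> Hom C A B. \<forall>q. is_cokernel C f q \<longrightarrow> Cod C q \<in> W)"

section \<open>Recollements\<close>

text \<open>The functors are not assumed to be additive: each is part of an adjoint pair between
  abelian categories, and is therefore additive. The naming reads
  \<open>i_ustar = i\<^sup>*\<close>, \<open>i_lstar = i\<^sub>*\<close>, \<open>i_ushriek = i\<^sup>!\<close>, \<open>j_lshriek = j\<^sub>!\<close>, \<open>j_ustar = j\<^sup>*\<close>,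
  \<open>j_lstar = j\<^sub>*\<close>.\<close>

locale recollement =
  Y: abelian_category \<Y> + X: abelian_category \<X> + Z: abelian_category \<Z>
  for \<Y> :: "('oY, 'mY, 'eY) acat_scheme"
    and \<X> :: "('oX, 'mX, 'eX) acat_scheme"
    and \<Z> :: "('oZ, 'mZ, 'eZ) acat_scheme" +
  fixes i_ustar :: "('oX, 'mX, 'oY, 'mY) funct"
    and i_lstar :: "('oY, 'mY, 'oX, 'mX) funct"
    and i_ushriek :: "('oX, 'mX, 'oY, 'mY) funct"
    and j_lshriek :: "('oZ, 'mZ, 'oX, 'mX) funct"
    and j_ustar :: "('oX, 'mX, 'oZ, 'mZ) funct"
    and j_lstar :: "('oZ, 'mZ, 'oX, 'mX) funct"
  assumes functor_i_ustar: "is_functor \<X> \<Y> i_ustar"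
    and functor_i_lstar: "is_functor \<Y> \<X> i_lstar"
    and functor_i_ushriek: "is_functor \<X> \<Y> i_ushriek"
    and functor_j_lshriek: "is_functor \<Z> \<X> j_lshriek"
    and functor_j_ustar: "is_functor \<X> \<Z> j_ustar"
    and functor_j_lstar: "is_functor \<Z> \<X> j_lstar"
    and adj_i_ustar_i_lstar: "adjoint_pair \<X> \<Y> i_ustar i_lstar"
    and adj_i_lstar_i_ushriek: "adjoint_pair \<Y> \<X> i_lstar i_ushriek"
    and adj_j_lshriek_j_ustar: "adjoint_pair \<Z> \<X> j_lshriek j_ustar"
    and adj_j_ustar_j_lstar: "adjoint_pair \<X> \<Z> j_ustar j_lstar"
    and ff_i_lstar: "fully_faithful \<Y> \<X> i_lstar"
    and ff_j_lshriek: "fully_faithful \<Z> \<X> j_lshriek"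
    and ff_j_lstar: "fully_faithful \<Z> \<X> j_lstar"
    and image_eq_kernel:
      "{A \<in> Obj \<X>. \<exists>B \<in> Obj \<Y>. isomorphic \<X> (on_obj i_lstar B) A} =
       {A \<in> Obj \<X>. is_zero_obj \<Z> (on_obj j_ustar A)}"

end

theory Submission
  imports Defs
begin

text \<open>Kernels and cokernels are preserved by \<open>j\<^sup>*\<close>, which has both adjoints, and by \<open>i\<^sup>!\<close>, which is
  exact; since wideness pulls back along such functors, (1) implies (2). The same argument for
  \<open>i\<^sub>*\<close> gives the converse for \<open>\<Y>\<close>, because \<open>j\<^sup>* i\<^sub>* = 0\<close> and \<open>i\<^sup>! i\<^sub>* \<cong> 1\<close> make \<open>W\<^sub>Y\<close> the preimage of \<open>W\<^sub>X\<close>.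
  For \<open>\<Z>\<close> one uses \<open>j\<^sub>*\<close>, where \<open>j\<^sup>* j\<^sub>* \<cong> 1\<close> and \<open>i\<^sup>! j\<^sub>* = 0\<close>. It is only left exact, so cokernels and
  extensions are handled through the cokernel \<open>Q\<close> of \<open>j\<^sub>* f\<close>: its image \<open>j\<^sup>* Q\<close> is the cokernel of \<open>f\<close>,
  and \<open>i\<^sup>! Q = 0\<close>, as \<open>i\<^sup>! Q\<close> is a quotient of \<open>i\<^sup>! j\<^sub>* (Cod f) = 0\<close>.\<close>

section \<open>Abelian categories\<close>

lemma HomD:
  assumes "f \<in> Hom C A B"
  shows "f \<in> Arr C" "Dom C f = A" "Cod C f = B"
  using assms by (auto simp: Hom_def)

context category
begin

lemma Hom_obj:
  assumes "f \<in> Hom C A B"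
  shows "A \<in> Obj C" "B \<in> Obj C"
  using assms dom_obj cod_obj by (auto simp: Hom_def)

lemma isomorphic_iff:
  "isomorphic C A B \<longleftrightarrow>
    (\<exists>f \<in> Hom C A B. \<exists>g \<in> Hom C B A. g \<cdot> f = Id C A \<and> f \<cdot> g = Id C B)"
  unfolding isomorphic_def is_iso_def Hom_def by auto

lemma isomorphic_sym: "isomorphic C A B \<Longrightarrow> isomorphic C B A"
  unfolding isomorphic_iff by blast

lemma subcategory_iso:
  assumes "subcategory C W" "isomorphic C A B"
  shows "A \<in> W \<longleftrightarrow> B \<in> W"
proof -
  have "A \<in> Obj C" "B \<in> Obj C"
    using assms(2) Hom_obj unfolding isomorphic_def by blast+
  then show ?thesis
    using assms isomorphic_sym unfolding subcategory_def by blast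
qed

lemma zero_objs_isomorphic:
  assumes "is_zero_obj C A" "is_zero_obj C B"
  shows "isomorphic C A B"
proof -
  have ob: "A \<in> Obj C" "B \<in> Obj C"
    using assms by (auto simp: is_zero_obj_def)
  then obtain f g where fg: "f \<in> Hom C A B" "g \<in> Hom C B A"
    using assms unfolding is_zero_obj_def by metis
  have "g \<cdot> f \<in> Hom C A A" "f \<cdot> g \<in> Hom C B B"
    using fg comp_hom by blast+
  then have "g \<cdot> f = Id C A" "f \<cdot> g = Id C B"
    using assms ob id_hom unfolding is_zero_obj_def by metis+
  then show ?thesis using fg unfolding isomorphic_iff by blast
qed

text \<open>Zero objects are unique up to isomorphism, and \<open>W\<close> is closed under
  isomorphism and contains one of them.\<close>

lemma subcategory_zero_obj:
  assumes "subcategory C W" "is_zero_obj C A"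
  shows "A \<in> W"
proof -
  obtain Z where "Z \<in> W" "is_zero_obj C Z" using assms(1) unfolding subcategory_def by blast
  then show ?thesis
    using subcategory_iso[OF assms(1) zero_objs_isomorphic[OF _ assms(2)]] by blast
qed

end

section \<open>Zero arrows, kernels and cokernels in preadditive categories\<close>

context preadditive_category
begin

lemma zero_hom: "\<lbrakk>A \<in> Obj C; B \<in> Obj C\<rbrakk> \<Longrightarrow> Zero C A B \<in> Hom C A B"
  using hom_group[of A B] unfolding comm_group_def comm_monoid_def Hom_group_def
  by (metis monoid.one_closed monoid.select_convs(2) partial_object.select_convs(1))

text \<open>Cancellation in the Hom group. It turns distributivity of composition into the
  absorption laws for zero arrows below.\<close>

lemma idem_add_zero:
  assumes "f \<in> Hom C A B" "f \<boxplus> f = f"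
  shows "f = Zero C A B"
proof -
  interpret H: comm_group "Hom_group C A B" using hom_group Hom_obj assms(1) by blast
  have "f \<otimes>\<^bsub>Hom_group C A B\<^esub> f = f" "f \<in> carrier (Hom_group C A B)"
    using assms by (simp_all add: Hom_group_def)
  then have "f = \<one>\<^bsub>Hom_group C A B\<^esub>" by (metis H.r_cancel_one)
  then show ?thesis by (simp add: Hom_group_def)
qed

lemma zero_add_zero:
  assumes "A \<in> Obj C" "B \<in> Obj C"
  shows "Zero C A B \<boxplus> Zero C A B = Zero C A B"
proof -
  interpret H: comm_group "Hom_group C A B" using hom_group assms by blast
  show ?thesis using H.l_one[OF H.one_closed] by (simp add: Hom_group_def)
qed

lemma comp_zero_left:
  assumes "f \<in> Hom C A B" "D \<in> Obj C"
  shows "Zero C B D \<cdot> f = Zero C A D"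
proof -
  have B: "B \<in> Obj C" using assms Hom_obj by blast
  have "(Zero C B D \<cdot> f) \<boxplus> (Zero C B D \<cdot> f) = Zero C B D \<cdot> f"
    using comp_add_left[OF assms(1)] zero_hom[OF B assms(2)] zero_add_zero[OF B assms(2)] by metis
  then show ?thesis
    using idem_add_zero comp_hom[OF assms(1) zero_hom[OF B assms(2)]] by blast
qed

lemma comp_zero_right:
  assumes "f \<in> Hom C A B" "D \<in> Obj C"
  shows "f \<cdot> Zero C D A = Zero C D B"
proof -
  have A: "A \<in> Obj C" using assms Hom_obj by blast
  have "(f \<cdot> Zero C D A) \<boxplus> (f \<cdot> Zero C D A) = f \<cdot> Zero C D A"
    using comp_add_right[OF _ _ assms(1)] zero_hom[OF assms(2) A] zero_add_zero[OF assms(2) A]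
    by metis
  then show ?thesis
    using idem_add_zero comp_hom[OF zero_hom[OF assms(2) A] assms(1)] by blast
qed

text \<open>If the identity of \<open>A\<close> is zero, every arrow into or out of \<open>A\<close>
  is a composite with a zero arrow. The criterion involves endomorphisms of \<open>A\<close> only,
  which is how zero objects are recognised through adjunctions later.\<close>

lemma is_zero_obj_iff: "is_zero_obj C A \<longleftrightarrow> A \<in> Obj C \<and> Id C A = Zero C A A"
proof (intro iffI conjI)
  assume "is_zero_obj C A"
  then show "A \<in> Obj C" "Id C A = Zero C A A"
    using id_hom zero_hom unfolding is_zero_obj_def by blast+
next
  assume A: "A \<in> Obj C \<and> Id C A = Zero C A A"
  have "f = Zero C B A" if "f \<in> Hom C B A" for f B
    using comp_id_left[OF that] comp_zero_left[OF that] A by simp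
  moreover have "f = Zero C A B" if "f \<in> Hom C A B" for f B
    using comp_id_right[OF that] comp_zero_right[OF that] A by simp
  ultimately show "is_zero_obj C A"
    unfolding is_zero_obj_def using A zero_hom by blast
qed

lemma zero_through_zero_obj:
  assumes "is_zero_obj C Z" "f \<in> Hom C A Z" "g \<in> Hom C Z B"
  shows "g \<cdot> f = Zero C A B"
proof -
  have ob: "A \<in> Obj C" "Z \<in> Obj C" "B \<in> Obj C"
    using assms Hom_obj by blast+
  have "f = Zero C A Z"
    using assms ob zero_hom unfolding is_zero_obj_def by blast
  then show ?thesis using comp_zero_right[OF assms(3) ob(1)] by simp
qed

text \<open>Adding the inverse \<open>u\<close> of \<open>t\<close> reduces equality of two
  composites with \<open>m\<close> to the vanishing of one: \<open>m\<close> sends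
  \<open>s \<boxplus> u\<close> to zero, so \<open>s \<boxplus> u\<close> is zero, just like
  \<open>t \<boxplus> u\<close>.\<close>

lemma mono_if_reflects_zero:
  assumes "m \<in> Hom C A B"
    and "\<And>T t. t \<in> Hom C T A \<Longrightarrow> m \<cdot> t = Zero C T B \<Longrightarrow> t = Zero C T A"
  shows "is_mono C m"
proof -
  have "s = t" if s: "s \<in> Hom C T A" and t: "t \<in> Hom C T A" and eq: "m \<cdot> s = m \<cdot> t" for T s t
  proof -
    have ob: "T \<in> Obj C" "A \<in> Obj C" "B \<in> Obj C" using s assms(1) Hom_obj by blast+
    interpret H: comm_group "Hom_group C T A" using hom_group ob by blast
    define u where "u = inv\<^bsub>Hom_group C T A\<^esub> t"
    have t': "t \<in> carrier (Hom_group C T A)" and s': "s \<in> carrier (Hom_group C T A)"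
      using s t by (simp_all add: Hom_group_def)
    have u: "u \<in> Hom C T A" and tu: "t \<boxplus> u = Zero C T A"
      using H.inv_closed[OF t'] H.r_inv[OF t'] unfolding u_def by (simp_all add: Hom_group_def)
    have su: "s \<boxplus> u \<in> Hom C T A"
      using H.m_closed[OF s' H.inv_closed[OF t']] unfolding u_def by (simp add: Hom_group_def)
    have "m \<cdot> (s \<boxplus> u) = m \<cdot> (t \<boxplus> u)"
      using comp_add_right[OF s u assms(1)] comp_add_right[OF t u assms(1)] eq by simp
    then have "m \<cdot> (s \<boxplus> u) = Zero C T B"
      using tu comp_zero_right[OF assms(1) ob(1)] by simp
    then have "s \<boxplus> u = t \<boxplus> u" using assms(2)[OF su] tu by simp
    then have "s \<otimes>\<^bsub>Hom_group C T A\<^esub> u = t \<otimes>\<^bsub>Hom_group C T A\<^esub> u"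
      by (simp add: Hom_group_def)
    then show "s = t"
      using H.right_cancel[OF _ s' t', of u] H.inv_closed[OF t'] unfolding u_def by blast
  qed
  then show ?thesis unfolding is_mono_def using HomD[OF assms(1)] by auto
qed

text \<open>The definition asks for unique factorisations of the arrows killed by \<open>f\<close>;
  here uniqueness is stated as left cancellation of \<open>k\<close>. The two agree because every
  composite \<open>k \<cdot> u\<close> is itself killed by \<open>f\<close>.\<close>

lemma is_kernel_iff:
  assumes "f \<in> Hom C A B" "k \<in> Hom C K A"
  shows "is_kernel C f k \<longleftrightarrow> f \<cdot> k = Zero C K B \<and>
    (\<forall>T t. t \<in> Hom C T A \<longrightarrow> f \<cdot> t = Zero C T B \<longrightarrow> (\<exists>u \<in> Hom C T K. k \<cdot> u = t)) \<and>
    (\<forall>T. \<forall>u \<in> Hom C T K. \<forall>v \<in> Hom C T K. k \<cdot> u = k \<cdot> v \<longrightarrow> u = v)"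
  (is "?l \<longleftrightarrow> ?r")
proof
  assume l: ?l
  have "u = v" if u: "u \<in> Hom C T K" and v: "v \<in> Hom C T K" and eq: "k \<cdot> u = k \<cdot> v" for T u v
  proof -
    have "f \<cdot> (k \<cdot> u) = Zero C T B"
      using comp_assoc[OF u assms(2,1)] comp_zero_left[OF u] Hom_obj[OF assms(1)] l HomD[OF assms(1)]
        HomD[OF assms(2)]
      unfolding is_kernel_def by metis
    moreover have "k \<cdot> u \<in> Hom C T A" "T \<in> Obj C"
      using comp_hom[OF u assms(2)] Hom_obj[OF u] by auto
    ultimately have "\<exists>!w. w \<in> Hom C T K \<and> k \<cdot> w = k \<cdot> u"
      using l HomD[OF assms(1)] HomD[OF assms(2)] unfolding is_kernel_def by auto
    then show ?thesis using u v eq by metis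
  qed
  then show ?r
    using l HomD[OF assms(1)] HomD[OF assms(2)] Hom_obj unfolding is_kernel_def by metis
next
  assume ?r
  then show ?l
    using HomD[OF assms(1)] HomD[OF assms(2)] unfolding is_kernel_def by (auto 0 4)
qed

text \<open>Dual form: uniqueness becomes right cancellation of \<open>q\<close>, since
  \<open>(u \<cdot> q) \<cdot> f\<close> always vanishes.\<close>

lemma is_cokernel_iff:
  assumes "f \<in> Hom C A B" "q \<in> Hom C B Q"
  shows "is_cokernel C f q \<longleftrightarrow> q \<cdot> f = Zero C A Q \<and>
    (\<forall>T t. t \<in> Hom C B T \<longrightarrow> t \<cdot> f = Zero C A T \<longrightarrow> (\<exists>u \<in> Hom C Q T. u \<cdot> q = t)) \<and>
    (\<forall>T. \<forall>u \<in> Hom C Q T. \<forall>v \<in> Hom C Q T. u \<cdot> q = v \<cdot> q \<longrightarrow> u = v)"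
  (is "?l \<longleftrightarrow> ?r")
proof
  assume l: ?l
  have "u = v" if u: "u \<in> Hom C Q T" and v: "v \<in> Hom C Q T" and eq: "u \<cdot> q = v \<cdot> q" for T u v
  proof -
    have "(u \<cdot> q) \<cdot> f = Zero C A T"
      using comp_assoc[OF assms u] comp_zero_right[OF u] Hom_obj[OF assms(1)] l HomD[OF assms(1)]
        HomD[OF assms(2)]
      unfolding is_cokernel_def by metis
    moreover have "u \<cdot> q \<in> Hom C B T" "T \<in> Obj C"
      using comp_hom[OF assms(2) u] Hom_obj[OF u] by auto
    ultimately have "\<exists>!w. w \<in> Hom C Q T \<and> w \<cdot> q = u \<cdot> q"
      using l HomD[OF assms(1)] HomD[OF assms(2)] unfolding is_cokernel_def by auto
    then show ?thesis using u v eq by metis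
  qed
  then show ?r
    using l HomD[OF assms(1)] HomD[OF assms(2)] Hom_obj unfolding is_cokernel_def by metis
next
  assume ?r
  then show ?l
    using HomD[OF assms(1)] HomD[OF assms(2)] unfolding is_cokernel_def by (auto 0 4)
qed

lemma kernel_hom:
  assumes "is_kernel C f k"
  shows "f \<in> Hom C (Dom C f) (Cod C f)" "k \<in> Hom C (Dom C k) (Dom C f)"
  using assms unfolding is_kernel_def Hom_def by auto

lemma cokernel_hom:
  assumes "is_cokernel C f q"
  shows "f \<in> Hom C (Dom C f) (Cod C f)" "q \<in> Hom C (Cod C f) (Cod C q)"
  using assms unfolding is_cokernel_def Hom_def by auto

lemma cokernel_epi:
  assumes "is_cokernel C f q"
  shows "is_epi C q"
proof -
  note q = cokernel_hom(2)[OF assms]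
  show ?thesis
    using assms[unfolded is_cokernel_iff[OF cokernel_hom[OF assms]]] HomD[OF q]
    unfolding is_epi_def by simp
qed

lemma cokernel_unique:
  assumes "is_cokernel C f q" "is_cokernel C f q'"
  shows "isomorphic C (Cod C q) (Cod C q')"
proof -
  define A B Q Q' where "A = Dom C f" and "B = Cod C f" and "Q = Cod C q" and "Q' = Cod C q'"
  have f: "f \<in> Hom C A B" and q: "q \<in> Hom C B Q" and q': "q' \<in> Hom C B Q'"
    using cokernel_hom[OF assms(1)] cokernel_hom[OF assms(2)]
    by (auto simp: A_def B_def Q_def Q'_def)
  note c = assms(1)[unfolded is_cokernel_iff[OF f q]] assms(2)[unfolded is_cokernel_iff[OF f q']]
  obtain u where u: "u \<in> Hom C Q Q'" "u \<cdot> q = q'" using c q' by metis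
  obtain v where v: "v \<in> Hom C Q' Q" "v \<cdot> q' = q" using c q by metis
  have "(v \<cdot> u) \<cdot> q = Id C Q \<cdot> q" "(u \<cdot> v) \<cdot> q' = Id C Q' \<cdot> q'"
    using comp_assoc[OF q u(1) v(1)] comp_assoc[OF q' v(1) u(1)] u v
      comp_id_left[OF q] comp_id_left[OF q'] by simp_all
  moreover have "v \<cdot> u \<in> Hom C Q Q" "u \<cdot> v \<in> Hom C Q' Q'" "Id C Q \<in> Hom C Q Q" "Id C Q' \<in> Hom C Q' Q'"
    using u v comp_hom id_hom Hom_obj by blast+
  ultimately have "v \<cdot> u = Id C Q" "u \<cdot> v = Id C Q'" using c by blast+
  then show ?thesis using u v unfolding isomorphic_iff Q_def Q'_def by blast
qed

text \<open>The commuting square lets test arrows be moved between \<open>B\<close> and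
  \<open>B'\<close> along \<open>b\<close> and its inverse. The right inverse \<open>a'\<close>
  serves to cancel \<open>a\<close> in composites that end with it on the right.\<close>

lemma cokernel_of_iso_arrow:
  assumes "is_cokernel C f g" "f \<in> Hom C A B" "f' \<in> Hom C A' B'"
    and a: "a \<in> Hom C A' A" "a' \<in> Hom C A A'" "a \<cdot> a' = Id C A"
    and b: "b \<in> Hom C B' B" "b' \<in> Hom C B B'" "b' \<cdot> b = Id C B'" "b \<cdot> b' = Id C B"
    and sq: "f \<cdot> a = b \<cdot> f'"
  shows "is_cokernel C f' (g \<cdot> b)"
proof -
  define Q where "Q = Cod C g"
  have g: "g \<in> Hom C B Q"
    using cokernel_hom[OF assms(1)] HomD[OF assms(2)] by (auto simp: Q_def)
  note f = assms(2) and f' = assms(3)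
  note c = assms(1)[unfolded is_cokernel_iff[OF f g]]
  have gb: "g \<cdot> b \<in> Hom C B' Q" using g b comp_hom by blast
  have ob: "A \<in> Obj C" "A' \<in> Obj C" "B \<in> Obj C" "B' \<in> Obj C" "Q \<in> Obj C"
    using f f' g Hom_obj by blast+
  have "(g \<cdot> b) \<cdot> f' = (g \<cdot> f) \<cdot> a"
    using comp_assoc[OF f' b(1) g] comp_assoc[OF a(1) f g] sq by simp
  then have "(g \<cdot> b) \<cdot> f' = Zero C A' Q"
    using c comp_zero_left[OF a(1) ob(5)] by simp
  moreover have "\<exists>u \<in> Hom C Q T. u \<cdot> (g \<cdot> b) = t"
    if t: "t \<in> Hom C B' T" and 0: "t \<cdot> f' = Zero C A' T" for T t
  proof -
    have T: "T \<in> Obj C" using t Hom_obj by blast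
    \<comment> \<open>The test arrow corresponding to \<open>t\<close> is
      \<open>t \<cdot> b'\<close>. Precomposed with \<open>f \<cdot> a\<close> it becomes
      \<open>t \<cdot> f'\<close>, which is zero, and then \<open>a\<close> is cancelled by
      \<open>a'\<close>.\<close>
    have tb: "t \<cdot> b' \<in> Hom C B T" and fa: "f \<cdot> a \<in> Hom C A' B"
      using t b f a comp_hom by blast+
    have "b' \<cdot> (f \<cdot> a) = f'"
      using sq comp_assoc[OF f' b(1,2)] b comp_id_left[OF f'] by simp
    then have "(t \<cdot> b') \<cdot> (f \<cdot> a) = Zero C A' T"
      using comp_assoc[OF fa b(2) t] 0 by simp
    then have "((t \<cdot> b') \<cdot> f) \<cdot> a = Zero C A' T"
      using comp_assoc[OF a(1) f tb] by simp
    then have "((t \<cdot> b') \<cdot> f) \<cdot> (a \<cdot> a') = Zero C A T"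
      using comp_assoc[OF a(2,1) comp_hom[OF f tb]] comp_zero_left[OF a(2) T] by simp
    then have "(t \<cdot> b') \<cdot> f = Zero C A T"
      using a(3) comp_id_right[OF comp_hom[OF f tb]] by simp
    then obtain u where u: "u \<in> Hom C Q T" "u \<cdot> g = t \<cdot> b'" using c tb by metis
    then have "u \<cdot> (g \<cdot> b) = t"
      using comp_assoc[OF b(1) g u(1)] comp_assoc[OF b(1,2) t] b(3) comp_id_right[OF t] by simp
    then show ?thesis using u by blast
  qed
  moreover have "u = v"
    if u: "u \<in> Hom C Q T" and v: "v \<in> Hom C Q T" and eq: "u \<cdot> (g \<cdot> b) = v \<cdot> (g \<cdot> b)" for T u v
  proof -
    have *: "(w \<cdot> (g \<cdot> b)) \<cdot> b' = w \<cdot> g" if w: "w \<in> Hom C Q T" for w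
      using comp_assoc[OF b(2) gb w] comp_assoc[OF b(2,1) g] b(4) comp_id_right[OF g] by simp
    have "u \<cdot> g = v \<cdot> g" using *[OF u] *[OF v] eq by simp
    then show ?thesis using c u v by blast
  qed
  ultimately show ?thesis unfolding is_cokernel_iff[OF f' gb] by blast
qed

text \<open>A cokernel is epi; starting at a zero object it is also a zero arrow, and cancelling it
  identifies the identity of its codomain with zero.\<close>

lemma cokernel_zero_obj:
  assumes "is_cokernel C f q" "is_zero_obj C (Cod C f)"
  shows "is_zero_obj C (Cod C q)"
proof -
  define B Q where "B = Cod C f" and "Q = Cod C q"
  have q: "q \<in> Hom C B Q" using cokernel_hom[OF assms(1)] by (auto simp: B_def Q_def)
  have ob: "B \<in> Obj C" "Q \<in> Obj C" using q Hom_obj by blast+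
  have "q = Zero C B Q"
    using assms(2) q ob zero_hom unfolding is_zero_obj_def B_def by blast
  then have "Id C Q \<cdot> q = Zero C Q Q \<cdot> q"
    using comp_id_left[OF q] comp_zero_left[OF q ob(2)] by simp
  then have "Id C Q = Zero C Q Q"
    using cokernel_epi[OF assms(1)] ob id_hom[OF ob(2)] zero_hom[OF ob(2) ob(2)] HomD[OF q]
    unfolding is_epi_def by blast
  then show ?thesis using is_zero_obj_iff ob Q_def by blast
qed

text \<open>A kernel is the kernel of its own cokernel: \<open>h \<cdot> m\<close> is zero, so
  \<open>h\<close> factors through \<open>q\<close>, and whatever \<open>q\<close> kills is then
  killed by \<open>h\<close> too.\<close>

lemma kernel_cokernel_of_mono_kernel:
  assumes "is_kernel C h m" "is_cokernel C m q"
  shows "short_exact C m q"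
proof -
  define A B D where "A = Dom C h" and "B = Cod C h" and "D = Dom C m"
  have h: "h \<in> Hom C A B" and m: "m \<in> Hom C D A"
    using kernel_hom[OF assms(1)] by (auto simp: A_def B_def D_def)
  define Q where "Q = Cod C q"
  have q: "q \<in> Hom C A Q"
    using cokernel_hom[OF assms(2)] HomD[OF m] by (auto simp: Q_def)
  note k = assms(1)[unfolded is_kernel_iff[OF h m]] and c = assms(2)[unfolded is_cokernel_iff[OF m q]]
  obtain r where r: "r \<in> Hom C Q B" "r \<cdot> q = h" using c h k by blast
  have "h \<cdot> t = Zero C T B" if t: "t \<in> Hom C T A" and 0: "q \<cdot> t = Zero C T Q" for T t
    using comp_assoc[OF t q r(1)] r(2) 0 comp_zero_right[OF r(1)] Hom_obj[OF t] by simp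
  then have "is_kernel C q m"
    unfolding is_kernel_iff[OF q m] using k c by blast
  then show ?thesis using assms(2) unfolding short_exact_def by blast
qed

end

section \<open>Factorisation through the coimage\<close>

context abelian_category
begin

text \<open>Here \<open>k\<close> is the kernel of \<open>f\<close>, \<open>c\<close> the cokernel
  of \<open>k\<close>, and \<open>m\<close> the induced arrow. That \<open>m\<close> is mono rests
  on every epi being a cokernel. The factorisation later reduces arbitrary cokernels to short exact
  sequences.\<close>

lemma coimage_mono:
  assumes f: "f \<in> Hom C A B"
  obtains k c m where "short_exact C k c" "m \<in> Hom C (Cod C c) B" "Dom C c = A" "m \<cdot> c = f" "is_mono C m"
proof -
  obtain k where k0: "is_kernel C f k" using ex_kernel HomD(1)[OF f] by blast
  define K where "K = Dom C k"
  have k: "k \<in> Hom C K A" using kernel_hom[OF k0] HomD[OF f] by (simp add: K_def)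
  obtain c where c0: "is_cokernel C k c" using ex_cokernel HomD(1)[OF k] by blast
  define I where "I = Cod C c"
  have c: "c \<in> Hom C A I" using cokernel_hom[OF c0] HomD[OF k] by (simp add: I_def)
  note kk = k0[unfolded is_kernel_iff[OF f k]] and cc = c0[unfolded is_cokernel_iff[OF k c]]
  obtain m where m: "m \<in> Hom C I B" "m \<cdot> c = f" using kk cc f by blast
  have "t = Zero C T I" if t: "t \<in> Hom C T I" and 0: "m \<cdot> t = Zero C T B" for T t
  proof -
    \<comment> \<open>Since \<open>q \<cdot> t\<close> is zero, it suffices to find a left inverse
      of \<open>q\<close>. As \<open>m \<cdot> t\<close> vanishes, \<open>m\<close> factors through
      \<open>q\<close>.\<close>
    obtain q where q0: "is_cokernel C t q" using ex_cokernel HomD(1)[OF t] by blast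
    define Q where "Q = Cod C q"
    have q: "q \<in> Hom C I Q" using cokernel_hom[OF q0] HomD[OF t] by (simp add: Q_def)
    note qq = q0[unfolded is_cokernel_iff[OF t q]]
    obtain m' where m': "m' \<in> Hom C Q B" "m' \<cdot> q = m" using qq m 0 by blast
    have qc: "q \<cdot> c \<in> Hom C A Q" using q c comp_hom by blast
    have "u = v" if u: "u \<in> Hom C Q S" and v: "v \<in> Hom C Q S" and eq: "u \<cdot> (q \<cdot> c) = v \<cdot> (q \<cdot> c)"
      for S u v
      using eq comp_assoc[OF c q u] comp_assoc[OF c q v] cc qq u v
        comp_hom[OF q u] comp_hom[OF q v] by metis
    then have "is_epi C (q \<cdot> c)" unfolding is_epi_def using HomD[OF qc] by blast
    \<comment> \<open>Because \<open>f\<close> factors through \<open>q \<cdot> c\<close>, it kills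
      \<open>h\<close>; so \<open>h\<close> factors through the kernel \<open>k\<close>, and
      \<open>c\<close> kills \<open>h\<close>. Hence \<open>c\<close> factors back through
      \<open>q \<cdot> c\<close>, and the factor \<open>s\<close> is the left inverse of
      \<open>q\<close>.\<close>
    then obtain h where h0: "is_cokernel C h (q \<cdot> c)" using epi_is_cokernel by blast
    define H where "H = Dom C h"
    have h: "h \<in> Hom C H A" using cokernel_hom[OF h0] h0 HomD[OF qc] by (auto simp: H_def is_cokernel_def)
    note hh = h0[unfolded is_cokernel_iff[OF h qc]]
    have ob: "H \<in> Obj C" "K \<in> Obj C" "I \<in> Obj C" "T \<in> Obj C" "Q \<in> Obj C"
      using h k c t q Hom_obj by blast+
    have "f = m' \<cdot> (q \<cdot> c)" using comp_assoc[OF c q m'(1)] m' m by simp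
    then have "f \<cdot> h = Zero C H B"
      using comp_assoc[OF h qc m'(1)] hh comp_zero_right[OF m'(1) ob(1)] by simp
    then obtain h' where h': "h' \<in> Hom C H K" "k \<cdot> h' = h" using kk h by blast
    have "c \<cdot> h = Zero C H I"
      using comp_assoc[OF h'(1) k c] h'(2) cc comp_zero_left[OF h'(1) ob(3)] by simp
    then obtain s where s: "s \<in> Hom C Q I" "s \<cdot> (q \<cdot> c) = c" using hh c by blast
    have "(s \<cdot> q) \<cdot> c = Id C I \<cdot> c" using comp_assoc[OF c q s(1)] s(2) comp_id_left[OF c] by simp
    then have "s \<cdot> q = Id C I" using cc comp_hom[OF q s(1)] id_hom[OF ob(3)] by blast
    then have "t = s \<cdot> (q \<cdot> t)" using comp_assoc[OF t q s(1)] comp_id_left[OF t] by simp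
    then show ?thesis using qq comp_zero_right[OF s(1) ob(4)] by simp
  qed
  then have "is_mono C m" using mono_if_reflects_zero[OF m(1)] by blast
  then show ?thesis
    using that[OF kernel_cokernel_of_mono_kernel[OF k0 c0] m(1)[unfolded I_def] HomD(2)[OF c] m(2)] by blast
qed

end

section \<open>Functors and adjunctions\<close>

locale functor_between = C: abelian_category C + D: abelian_category D
  for C :: "('oC, 'mC, 'eC) acat_scheme" and D :: "('oD, 'mD, 'eD) acat_scheme" +
  fixes F :: "('oC, 'mC, 'oD, 'mD) funct"
  assumes F: "is_functor C D F"
begin

lemma obj: "A \<in> Obj C \<Longrightarrow> on_obj F A \<in> Obj D"
  using F unfolding is_functor_def by blast

lemma hom: "f \<in> Hom C A B \<Longrightarrow> on_arr F f \<in> Hom D (on_obj F A) (on_obj F B)"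
  using F C.Hom_obj[of f A B] unfolding is_functor_def by blast

lemma ident: "A \<in> Obj C \<Longrightarrow> on_arr F (Id C A) = Id D (on_obj F A)"
  using F unfolding is_functor_def by blast

lemma comp:
  assumes "f \<in> Hom C A B" "g \<in> Hom C B E"
  shows "on_arr F (g \<cdot>\<^bsub>C\<^esub> f) = on_arr F g \<cdot>\<^bsub>D\<^esub> on_arr F f"
  using F HomD[OF assms(1)] HomD[OF assms(2)] unfolding is_functor_def by auto

lemma iso:
  assumes "isomorphic C A B"
  shows "isomorphic D (on_obj F A) (on_obj F B)"
proof -
  obtain f g where f: "f \<in> Hom C A B" and g: "g \<in> Hom C B A"
    and fg: "g \<cdot>\<^bsub>C\<^esub> f = Id C A" "f \<cdot>\<^bsub>C\<^esub> g = Id C B"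
    using assms C.isomorphic_iff by blast
  then have "on_arr F g \<cdot>\<^bsub>D\<^esub> on_arr F f = Id D (on_obj F A)"
    "on_arr F f \<cdot>\<^bsub>D\<^esub> on_arr F g = Id D (on_obj F B)"
    using comp[OF f g] comp[OF g f] ident C.Hom_obj[OF f] by simp_all
  then show ?thesis using hom[OF f] hom[OF g] D.isomorphic_iff by blast
qed

end

text \<open>Stands in for additivity: preserved zero objects already give preserved zero arrows, and
  both functors of an adjoint pair satisfy it.\<close>

locale zero_functor_between = functor_between +
  assumes zero_obj: "is_zero_obj C A \<Longrightarrow> is_zero_obj D (on_obj F A)"
begin

lemma zero:
  assumes "A \<in> Obj C" "B \<in> Obj C"
  shows "on_arr F (Zero C A B) = Zero D (on_obj F A) (on_obj F B)"
proof -
  obtain Z where Z: "is_zero_obj C Z" using C.ex_zero_obj by blast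
  then have ZO: "Z \<in> Obj C" by (simp add: is_zero_obj_def)
  note h = C.zero_hom[OF assms(1) ZO] C.zero_hom[OF ZO assms(2)]
  show ?thesis
    using C.zero_through_zero_obj[OF Z h] comp[OF h]
      D.zero_through_zero_obj[OF zero_obj[OF Z] hom[OF h(1)] hom[OF h(2)]] by simp
qed

end

text \<open>\<open>exact_functor\<close> speaks of short exact sequences only, so \<open>f\<close>
  is split as \<open>m \<cdot> c\<close> with \<open>m\<close> mono and \<open>c\<close> a cokernel.
  Then \<open>q\<close> is also a cokernel of \<open>m\<close>, and both \<open>k\<close>,
  \<open>c\<close> and \<open>m\<close>, \<open>q\<close> are short exact.\<close>

lemma (in functor_between) exact_cokernel:
  assumes ex: "exact_functor C D F" and q0: "is_cokernel C f q"
  shows "is_cokernel D (on_arr F f) (on_arr F q)"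
proof -
  define A B Q where "A = Dom C f" and "B = Cod C f" and "Q = Cod C q"
  have f: "f \<in> Hom C A B" and q: "q \<in> Hom C B Q"
    using C.cokernel_hom[OF q0] by (auto simp: A_def B_def Q_def)
  note qq = q0[unfolded C.is_cokernel_iff[OF f q]]
  obtain k c m where kc: "short_exact C k c" and m: "m \<in> Hom C (Cod C c) B" "m \<cdot>\<^bsub>C\<^esub> c = f"
    and mono: "is_mono C m" and Dc: "Dom C c = A" using C.coimage_mono[OF f] by blast
  define I K where "I = Cod C c" and "K = Dom C k"
  have c0: "is_cokernel C k c" using kc by (simp add: short_exact_def)
  have k: "k \<in> Hom C K A" and c: "c \<in> Hom C A I"
    using C.cokernel_hom[OF c0] Dc c0 by (auto simp: I_def K_def is_cokernel_def)
  note m = m[folded I_def]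
  note cc = c0[unfolded C.is_cokernel_iff[OF k c]]
  \<comment> \<open>Right cancellation of \<open>c\<close> shows that \<open>f\<close> and
    \<open>m\<close> are killed by the same arrows, hence have the same cokernels.\<close>
  have cancel: "t \<cdot>\<^bsub>C\<^esub> f = Zero C A T \<longleftrightarrow> t \<cdot>\<^bsub>C\<^esub> m = Zero C I T" if t: "t \<in> Hom C B T" for t T
  proof -
    have I: "I \<in> Obj C" and T: "T \<in> Obj C" using c t C.Hom_obj by blast+
    have "t \<cdot>\<^bsub>C\<^esub> f = (t \<cdot>\<^bsub>C\<^esub> m) \<cdot>\<^bsub>C\<^esub> c" using C.comp_assoc[OF c m(1) t] m(2) by simp
    then show ?thesis
      using C.comp_zero_left[OF c T] cc C.comp_hom[OF m(1) t] C.zero_hom[OF I T] by metis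
  qed
  have "is_cokernel C m q"
    unfolding C.is_cokernel_iff[OF m(1) q] using qq cancel q by blast
  moreover obtain h where "is_kernel C h m" using C.mono_is_kernel[OF mono] by blast
  ultimately have "short_exact C m q" using C.kernel_cokernel_of_mono_kernel by blast
  then have Fq0: "is_cokernel D (on_arr F m) (on_arr F q)" and Fc0: "is_cokernel D (on_arr F k) (on_arr F c)"
    using ex kc unfolding exact_functor_def short_exact_def by blast+
  note Fqq = Fq0[unfolded D.is_cokernel_iff[OF hom[OF m(1)] hom[OF q]]]
  note Fcc = Fc0[unfolded D.is_cokernel_iff[OF hom[OF k] hom[OF c]]]
  \<comment> \<open>The image of \<open>c\<close> is again a cokernel, so the same cancellation
    works in \<open>D\<close> and leads back from \<open>m\<close> to \<open>f\<close>.\<close>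
  have cancelF: "t \<cdot>\<^bsub>D\<^esub> on_arr F f = Zero D (on_obj F A) T \<longleftrightarrow> t \<cdot>\<^bsub>D\<^esub> on_arr F m = Zero D (on_obj F I) T"
    if t: "t \<in> Hom D (on_obj F B) T" for t T
  proof -
    have I: "on_obj F I \<in> Obj D" and T: "T \<in> Obj D" using hom[OF c] t D.Hom_obj by blast+
    have "t \<cdot>\<^bsub>D\<^esub> on_arr F f = (t \<cdot>\<^bsub>D\<^esub> on_arr F m) \<cdot>\<^bsub>D\<^esub> on_arr F c"
      using D.comp_assoc[OF hom[OF c] hom[OF m(1)] t] m(2) comp[OF c m(1)] by simp
    then show ?thesis
      using D.comp_zero_left[OF hom[OF c] T] Fcc D.comp_hom[OF hom[OF m(1)] t] D.zero_hom[OF I T]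
      by metis
  qed
  show ?thesis
    unfolding D.is_cokernel_iff[OF hom[OF f] hom[OF q]] using Fqq cancelF hom[OF q] by blast
qed

section \<open>Adjunctions: preserved kernels and cokernels, units and counits\<close>

locale adjunction =
  C: abelian_category C + D: abelian_category D + F: functor_between C D F + G: functor_between D C G
  for C :: "('oC, 'mC, 'eC) acat_scheme" and D :: "('oD, 'mD, 'eD) acat_scheme" and F G +
  fixes \<phi> :: "'oC \<Rightarrow> 'oD \<Rightarrow> 'mD \<Rightarrow> 'mC"
  assumes bij: "\<lbrakk>A \<in> Obj C; B \<in> Obj D\<rbrakk> \<Longrightarrow>
      bij_betw (\<phi> A B) (Hom D (on_obj F A) B) (Hom C A (on_obj G B))"
    and nat_left: "\<lbrakk>a \<in> Hom C A' A; h \<in> Hom D (on_obj F A) B\<rbrakk> \<Longrightarrow>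
      \<phi> A' B (h \<cdot>\<^bsub>D\<^esub> on_arr F a) = \<phi> A B h \<cdot>\<^bsub>C\<^esub> a"
    and nat_right: "\<lbrakk>A \<in> Obj C; b \<in> Hom D B B'; h \<in> Hom D (on_obj F A) B\<rbrakk> \<Longrightarrow>
      \<phi> A B' (b \<cdot>\<^bsub>D\<^esub> h) = on_arr G b \<cdot>\<^bsub>C\<^esub> \<phi> A B h"
begin

lemma phi_hom: "\<lbrakk>A \<in> Obj C; h \<in> Hom D (on_obj F A) B\<rbrakk> \<Longrightarrow> \<phi> A B h \<in> Hom C A (on_obj G B)"
  by (rule bij_betw_apply[OF bij]) (auto dest: D.Hom_obj)

lemma phi_inj:
  "\<lbrakk>A \<in> Obj C; h \<in> Hom D (on_obj F A) B; h' \<in> Hom D (on_obj F A) B; \<phi> A B h = \<phi> A B h'\<rbrakk> \<Longrightarrow> h = h'"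
  by (rule inj_onD[OF bij_betw_imp_inj_on[OF bij]]) (auto dest: D.Hom_obj)

lemma phi_surj:
  assumes "B \<in> Obj D" "t \<in> Hom C A (on_obj G B)"
  obtains h where "h \<in> Hom D (on_obj F A) B" "\<phi> A B h = t"
proof -
  have "\<phi> A B ` Hom D (on_obj F A) B = Hom C A (on_obj G B)"
    using bij C.Hom_obj assms unfolding bij_betw_def by blast
  then show ?thesis using that assms(2) by (metis imageE)
qed

text \<open>Endomorphisms of \<open>on_obj G Z\<close> are transposes of arrows into
  \<open>Z\<close>, and there is exactly one of those from a given object; so identity and zero
  agree.\<close>

lemma right_zero_obj:
  assumes "is_zero_obj D Z"
  shows "is_zero_obj C (on_obj G Z)"
proof -
  have Z: "Z \<in> Obj D" and GZ: "on_obj G Z \<in> Obj C"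
    using assms G.obj by (auto simp: is_zero_obj_def)
  have "s = t" if s: "s \<in> Hom C (on_obj G Z) (on_obj G Z)" and t: "t \<in> Hom C (on_obj G Z) (on_obj G Z)"
    for s t
  proof -
    obtain s' where s': "s' \<in> Hom D (on_obj F (on_obj G Z)) Z" "\<phi> (on_obj G Z) Z s' = s"
      by (rule phi_surj[OF Z s])
    obtain t' where t': "t' \<in> Hom D (on_obj F (on_obj G Z)) Z" "\<phi> (on_obj G Z) Z t' = t"
      by (rule phi_surj[OF Z t])
    have "s' = t'"
      using s'(1) t'(1) assms F.obj[OF GZ] unfolding is_zero_obj_def by blast
    then show ?thesis using s' t' by simp
  qed
  then show ?thesis using C.is_zero_obj_iff GZ C.id_hom C.zero_hom by blast
qed

lemma left_zero_obj:
  assumes "is_zero_obj C Z"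
  shows "is_zero_obj D (on_obj F Z)"
proof -
  have Z: "Z \<in> Obj C" and FZ: "on_obj F Z \<in> Obj D"
    using assms F.obj by (auto simp: is_zero_obj_def)
  have "s = t" if "s \<in> Hom D (on_obj F Z) (on_obj F Z)" "t \<in> Hom D (on_obj F Z) (on_obj F Z)" for s t
    using phi_hom[OF Z that(1)] phi_hom[OF Z that(2)] phi_inj[OF Z that] assms G.obj[OF FZ]
    unfolding is_zero_obj_def by blast
  then show ?thesis using D.is_zero_obj_iff FZ D.id_hom D.zero_hom by blast
qed

sublocale F: zero_functor_between C D F
  by unfold_locales (rule left_zero_obj)

sublocale G: zero_functor_between D C G
  by unfold_locales (rule right_zero_obj)

text \<open>\<open>\<phi>\<close> is only a natural bijection, so compatibility with zero comes from
  naturality: a zero arrow absorbs the zero endomorphism of \<open>B\<close>, and \<open>G\<close>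
  carries that endomorphism to a zero arrow.\<close>

lemma phi_zero:
  assumes A: "A \<in> Obj C" and h: "h \<in> Hom D (on_obj F A) B"
  shows "\<phi> A B h = Zero C A (on_obj G B) \<longleftrightarrow> h = Zero D (on_obj F A) B"
proof -
  have B: "B \<in> Obj D" using h D.Hom_obj by blast
  have z: "Zero D (on_obj F A) B \<in> Hom D (on_obj F A) B"
    using D.zero_hom F.obj A B by blast
  have "Zero D B B \<cdot>\<^bsub>D\<^esub> Zero D (on_obj F A) B = Zero D (on_obj F A) B"
    using D.comp_zero_left[OF z B] .
  then have "\<phi> A B (Zero D (on_obj F A) B) = on_arr G (Zero D B B) \<cdot>\<^bsub>C\<^esub> \<phi> A B (Zero D (on_obj F A) B)"
    using nat_right[OF A D.zero_hom[OF B B] z] by simp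
  also have "\<dots> = Zero C A (on_obj G B)"
    using G.zero[OF B B] C.comp_zero_left[OF phi_hom[OF A z]] G.obj[OF B] by simp
  finally show ?thesis using phi_inj[OF A h z] by auto
qed

text \<open>Each clause about arrows from \<open>T\<close> into the image of \<open>G\<close>
  transposes to the same clause about arrows out of \<open>on_obj F T\<close>, where the kernel
  property of \<open>k\<close> applies.\<close>

lemma right_kernel:
  assumes "is_kernel D f k"
  shows "is_kernel C (on_arr G f) (on_arr G k)"
proof -
  define A B K where "A = Dom D f" and "B = Cod D f" and "K = Dom D k"
  have f: "f \<in> Hom D A B" and k: "k \<in> Hom D K A"
    using D.kernel_hom[OF assms] by (auto simp: A_def B_def K_def)
  have ob: "A \<in> Obj D" "B \<in> Obj D" "K \<in> Obj D" using f k D.Hom_obj by blast+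
  note kk = assms[unfolded D.is_kernel_iff[OF f k]]
  have "on_arr G f \<cdot>\<^bsub>C\<^esub> on_arr G k = Zero C (on_obj G K) (on_obj G B)"
    using kk G.comp[OF k f] G.zero ob by simp
  moreover have "\<exists>u \<in> Hom C T (on_obj G K). on_arr G k \<cdot>\<^bsub>C\<^esub> u = t"
    if t: "t \<in> Hom C T (on_obj G A)" and 0: "on_arr G f \<cdot>\<^bsub>C\<^esub> t = Zero C T (on_obj G B)" for T t
  proof -
    have T: "T \<in> Obj C" using t C.Hom_obj by blast
    obtain s where s: "s \<in> Hom D (on_obj F T) A" "\<phi> T A s = t" by (rule phi_surj[OF ob(1) t])
    have "\<phi> T B (f \<cdot>\<^bsub>D\<^esub> s) = Zero C T (on_obj G B)" using nat_right[OF T f s(1)] s(2) 0 by simp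
    then have "f \<cdot>\<^bsub>D\<^esub> s = Zero D (on_obj F T) B" using phi_zero[OF T D.comp_hom[OF s(1) f]] by blast
    then obtain u where u: "u \<in> Hom D (on_obj F T) K" "k \<cdot>\<^bsub>D\<^esub> u = s" using kk s by blast
    then show ?thesis using nat_right[OF T k u(1)] s(2) phi_hom[OF T u(1)] by metis
  qed
  moreover have "u = v" if u: "u \<in> Hom C T (on_obj G K)" and v: "v \<in> Hom C T (on_obj G K)"
    and eq: "on_arr G k \<cdot>\<^bsub>C\<^esub> u = on_arr G k \<cdot>\<^bsub>C\<^esub> v" for T u v
  proof -
    have T: "T \<in> Obj C" using u C.Hom_obj by blast
    obtain u' where u': "u' \<in> Hom D (on_obj F T) K" "\<phi> T K u' = u" by (rule phi_surj[OF ob(3) u])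
    obtain v' where v': "v' \<in> Hom D (on_obj F T) K" "\<phi> T K v' = v" by (rule phi_surj[OF ob(3) v])
    have "\<phi> T A (k \<cdot>\<^bsub>D\<^esub> u') = \<phi> T A (k \<cdot>\<^bsub>D\<^esub> v')"
      using nat_right[OF T k u'(1)] nat_right[OF T k v'(1)] u' v' eq by simp
    then have "k \<cdot>\<^bsub>D\<^esub> u' = k \<cdot>\<^bsub>D\<^esub> v'"
      using phi_inj[OF T D.comp_hom[OF u'(1) k] D.comp_hom[OF v'(1) k]] by blast
    then show ?thesis using kk u' v' by blast
  qed
  ultimately show ?thesis unfolding C.is_kernel_iff[OF G.hom[OF f] G.hom[OF k]] by blast
qed

text \<open>The dual transposition: arrows out of the image of \<open>F\<close> become arrows into
  \<open>on_obj G T\<close>.\<close>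

lemma left_cokernel:
  assumes "is_cokernel C f q"
  shows "is_cokernel D (on_arr F f) (on_arr F q)"
proof -
  define A B Q where "A = Dom C f" and "B = Cod C f" and "Q = Cod C q"
  have f: "f \<in> Hom C A B" and q: "q \<in> Hom C B Q"
    using C.cokernel_hom[OF assms] by (auto simp: A_def B_def Q_def)
  have ob: "A \<in> Obj C" "B \<in> Obj C" "Q \<in> Obj C" using f q C.Hom_obj by blast+
  note qq = assms[unfolded C.is_cokernel_iff[OF f q]]
  have "on_arr F q \<cdot>\<^bsub>D\<^esub> on_arr F f = Zero D (on_obj F A) (on_obj F Q)"
    using qq F.comp[OF f q] F.zero ob by simp
  moreover have "\<exists>u \<in> Hom D (on_obj F Q) T. u \<cdot>\<^bsub>D\<^esub> on_arr F q = t"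
    if t: "t \<in> Hom D (on_obj F B) T" and 0: "t \<cdot>\<^bsub>D\<^esub> on_arr F f = Zero D (on_obj F A) T" for T t
  proof -
    have T: "T \<in> Obj D" using t D.Hom_obj by blast
    have "\<phi> B T t \<cdot>\<^bsub>C\<^esub> f = Zero C A (on_obj G T)"
      using nat_left[OF f t] phi_zero[OF ob(1) D.comp_hom[OF F.hom[OF f] t]] 0 by simp
    then obtain w where w: "w \<in> Hom C Q (on_obj G T)" "w \<cdot>\<^bsub>C\<^esub> q = \<phi> B T t"
      using qq phi_hom[OF ob(2) t] by blast
    obtain u where u: "u \<in> Hom D (on_obj F Q) T" "\<phi> Q T u = w" by (rule phi_surj[OF T w(1)])
    have "\<phi> B T (u \<cdot>\<^bsub>D\<^esub> on_arr F q) = \<phi> B T t" using nat_left[OF q u(1)] u w by simp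
    then have "u \<cdot>\<^bsub>D\<^esub> on_arr F q = t"
      using phi_inj[OF ob(2) D.comp_hom[OF F.hom[OF q] u(1)] t] by blast
    then show ?thesis using u by blast
  qed
  moreover have "u = v" if u: "u \<in> Hom D (on_obj F Q) T" and v: "v \<in> Hom D (on_obj F Q) T"
    and eq: "u \<cdot>\<^bsub>D\<^esub> on_arr F q = v \<cdot>\<^bsub>D\<^esub> on_arr F q" for T u v
  proof -
    have "\<phi> Q T u \<cdot>\<^bsub>C\<^esub> q = \<phi> Q T v \<cdot>\<^bsub>C\<^esub> q"
      using nat_left[OF q u] nat_left[OF q v] eq by simp
    then have "\<phi> Q T u = \<phi> Q T v" using qq phi_hom[OF ob(3) u] phi_hom[OF ob(3) v] by blast
    then show ?thesis using phi_inj[OF ob(3) u v] by blast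
  qed
  ultimately show ?thesis unfolding D.is_cokernel_iff[OF F.hom[OF f] F.hom[OF q]] by blast
qed

text \<open>The unit at \<open>A\<close> is \<open>\<phi> A (F A) 1\<close>; composing with it is \<open>a \<mapsto> \<phi> (F a)\<close>, which is bijective.\<close>

lemma unit_iso:
  assumes ff: "fully_faithful C D F" and A: "A \<in> Obj C"
  shows "isomorphic C A (on_obj G (on_obj F A))"
proof -
  define FA GFA e where "FA = on_obj F A" and "GFA = on_obj G FA" and "e = \<phi> A FA (Id D FA)"
  have FA: "FA \<in> Obj D" and GFA: "GFA \<in> Obj C" using A F.obj G.obj by (auto simp: FA_def GFA_def)
  have id: "Id D FA \<in> Hom D (on_obj F A) FA" using D.id_hom FA by (simp add: FA_def)
  have e: "e \<in> Hom C A GFA" using phi_hom[OF A id] by (simp add: e_def GFA_def)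
  have ea: "\<phi> T FA (on_arr F a) = e \<cdot>\<^bsub>C\<^esub> a" if a: "a \<in> Hom C T A" for T a
    using nat_left[OF a id] D.comp_id_left[OF F.hom[OF a]] by (simp add: e_def FA_def)
  obtain h where h: "h \<in> Hom D (on_obj F GFA) FA" "\<phi> GFA FA h = Id C GFA"
    using phi_surj[OF FA] C.id_hom[OF GFA] by (auto simp: GFA_def)
  obtain a where a: "a \<in> Hom C GFA A" "on_arr F a = h"
    using ff A GFA h(1) unfolding fully_faithful_def bij_betw_def FA_def by (metis imageE)
  have ea1: "e \<cdot>\<^bsub>C\<^esub> a = Id C GFA" using ea[OF a(1)] a(2) h(2) by simp
  have ae: "a \<cdot>\<^bsub>C\<^esub> e \<in> Hom C A A" using a e C.comp_hom by blast
  have idA: "Id C A \<in> Hom C A A" using C.id_hom A by blast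
  have "e \<cdot>\<^bsub>C\<^esub> (a \<cdot>\<^bsub>C\<^esub> e) = e \<cdot>\<^bsub>C\<^esub> Id C A"
    using C.comp_assoc[OF e a(1) e] ea1 C.comp_id_left[OF e] C.comp_id_right[OF e] by simp
  then have "on_arr F (a \<cdot>\<^bsub>C\<^esub> e) = on_arr F (Id C A)"
    using ea[OF ae] ea[OF idA] phi_inj[OF A] F.hom[OF ae] F.hom[OF idA] FA_def by metis
  then have "a \<cdot>\<^bsub>C\<^esub> e = Id C A"
    using ff A ae idA unfolding fully_faithful_def bij_betw_def inj_on_def by blast
  then show ?thesis
    using ea1 e a(1) unfolding C.isomorphic_iff GFA_def FA_def by blast
qed

text \<open>The counit \<open>e\<close> is the transpose of the identity of
  \<open>on_obj G B\<close>. Precomposition with \<open>e\<close> is, up to \<open>\<phi>\<close>,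
  the action of \<open>G\<close> on arrows, which is bijective by full faithfulness. The transpose
  equation is part of the conclusion because naturality of the counit is derived from it.\<close>

lemma counit:
  assumes ff: "fully_faithful D C G" and B: "B \<in> Obj D"
  obtains e e' where "e \<in> Hom D (on_obj F (on_obj G B)) B" "e' \<in> Hom D B (on_obj F (on_obj G B))"
    "e' \<cdot>\<^bsub>D\<^esub> e = Id D (on_obj F (on_obj G B))" "e \<cdot>\<^bsub>D\<^esub> e' = Id D B" "\<phi> (on_obj G B) B e = Id C (on_obj G B)"
proof -
  define GB FGB where "GB = on_obj G B" and "FGB = on_obj F GB"
  have GB: "GB \<in> Obj C" and FGB: "FGB \<in> Obj D" using B F.obj G.obj by (auto simp: GB_def FGB_def)
  obtain e where e: "e \<in> Hom D FGB B" "\<phi> GB B e = Id C GB"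
    using phi_surj[OF B] C.id_hom[OF GB] by (auto simp: GB_def FGB_def)
  have ea: "\<phi> GB T (b \<cdot>\<^bsub>D\<^esub> e) = on_arr G b" if b: "b \<in> Hom D B T" for T b
    using nat_right[OF GB b] e C.comp_id_right[OF G.hom[OF b]] by (simp add: GB_def FGB_def)
  have idF: "Id D FGB \<in> Hom D (on_obj F GB) FGB" using D.id_hom FGB by (simp add: FGB_def)
  have "\<phi> GB FGB (Id D FGB) \<in> Hom C (on_obj G B) (on_obj G FGB)"
    using phi_hom[OF GB idF] by (simp add: GB_def)
  \<comment> \<open>By \<open>ea\<close>, the desired equation \<open>a \<cdot> e = Id\<close>
    transposes to a prescribed value of \<open>on_arr G a\<close>; fullness of \<open>G\<close>
    provides such an \<open>a\<close>.\<close>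
  then obtain a where a: "a \<in> Hom D B FGB" "on_arr G a = \<phi> GB FGB (Id D FGB)"
    using ff B FGB unfolding fully_faithful_def bij_betw_def by (metis imageE)
  have ae: "a \<cdot>\<^bsub>D\<^esub> e \<in> Hom D (on_obj F GB) FGB" using D.comp_hom[OF e(1) a(1)] by (simp add: FGB_def)
  have ae1: "a \<cdot>\<^bsub>D\<^esub> e = Id D FGB" using phi_inj[OF GB ae idF] ea[OF a(1)] a(2) by simp
  have ea': "e \<cdot>\<^bsub>D\<^esub> a \<in> Hom D B B" using a e D.comp_hom by blast
  have idB: "Id D B \<in> Hom D B B" using D.id_hom B by blast
  have "(e \<cdot>\<^bsub>D\<^esub> a) \<cdot>\<^bsub>D\<^esub> e = Id D B \<cdot>\<^bsub>D\<^esub> e"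
    using D.comp_assoc[OF e(1) a(1) e(1)] ae1 D.comp_id_left[OF e(1)] D.comp_id_right[OF e(1)] by simp
  then have "on_arr G (e \<cdot>\<^bsub>D\<^esub> a) = on_arr G (Id D B)"
    using ea[OF ea'] ea[OF idB] by simp
  then have "e \<cdot>\<^bsub>D\<^esub> a = Id D B"
    using ff B ea' idB unfolding fully_faithful_def bij_betw_def inj_on_def by blast
  then show ?thesis using that[of e a] ae1 e a(1) by (simp add: GB_def FGB_def)
qed

lemma counit_iso:
  assumes "fully_faithful D C G" "B \<in> Obj D"
  shows "isomorphic D (on_obj F (on_obj G B)) B"
  by (rule counit[OF assms]) (use D.isomorphic_iff in blast)

text \<open>\<open>F\<close> preserves the cokernel \<open>q\<close>, and the counits at both ends
  identify \<open>F (G f)\<close> with \<open>f\<close>. This recovers the cokernel of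
  \<open>f\<close> even when \<open>G\<close> does not preserve cokernels.\<close>

lemma cokernel_via_right_adjoint:
  assumes ff: "fully_faithful D C G" and g: "is_cokernel D f g" and q: "is_cokernel C (on_arr G f) q"
  shows "isomorphic D (on_obj F (Cod C q)) (Cod D g)"
proof -
  define A B where "A = Dom D f" and "B = Cod D f"
  have f: "f \<in> Hom D A B" using D.cokernel_hom[OF g] by (auto simp: A_def B_def)
  have ob: "A \<in> Obj D" "B \<in> Obj D" using f D.Hom_obj by blast+
  obtain a a' where a: "a \<in> Hom D (on_obj F (on_obj G A)) A" "a' \<in> Hom D A (on_obj F (on_obj G A))"
    "a \<cdot>\<^bsub>D\<^esub> a' = Id D A" and pa: "\<phi> (on_obj G A) A a = Id C (on_obj G A)" using counit[OF ff ob(1)] by metis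
  obtain b b' where b: "b \<in> Hom D (on_obj F (on_obj G B)) B" "b' \<in> Hom D B (on_obj F (on_obj G B))"
    "b' \<cdot>\<^bsub>D\<^esub> b = Id D (on_obj F (on_obj G B))" "b \<cdot>\<^bsub>D\<^esub> b' = Id D B"
    and pb: "\<phi> (on_obj G B) B b = Id C (on_obj G B)" using counit[OF ff ob(2)] by metis
  have Gf: "on_arr G f \<in> Hom C (on_obj G A) (on_obj G B)" using G.hom[OF f] .
  have GA: "on_obj G A \<in> Obj C" using G.obj ob by blast
  \<comment> \<open>Naturality of the counit: both sides of the square transpose to
    \<open>on_arr G f\<close>.\<close>
  have "\<phi> (on_obj G A) B (f \<cdot>\<^bsub>D\<^esub> a) = on_arr G f"
    using nat_right[OF GA f a(1)] pa C.comp_id_right[OF Gf] by simp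
  moreover have "\<phi> (on_obj G A) B (b \<cdot>\<^bsub>D\<^esub> on_arr F (on_arr G f)) = on_arr G f"
    using nat_left[OF Gf b(1)] pb C.comp_id_left[OF Gf] by simp
  ultimately have "f \<cdot>\<^bsub>D\<^esub> a = b \<cdot>\<^bsub>D\<^esub> on_arr F (on_arr G f)"
    using phi_inj[OF GA D.comp_hom[OF a(1) f] D.comp_hom[OF F.hom[OF Gf] b(1)]] by simp
  then have "is_cokernel D (on_arr F (on_arr G f)) (g \<cdot>\<^bsub>D\<^esub> b)"
    using D.cokernel_of_iso_arrow[OF g f F.hom[OF Gf] a b] by blast
  moreover have "is_cokernel D (on_arr F (on_arr G f)) (on_arr F q)"
    using left_cokernel[OF q] .
  moreover have "Cod D (g \<cdot>\<^bsub>D\<^esub> b) = Cod D g"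
    using D.comp_hom[OF b(1), of g "Cod D g"] D.cokernel_hom(2)[OF g] HomD(3) B_def by metis
  moreover have "Cod D (on_arr F q) = on_obj F (Cod C q)"
    using F.hom[OF C.cokernel_hom(2)[OF q]] HomD(3) by metis
  ultimately show ?thesis using D.cokernel_unique by metis
qed

end

lemma adjunctionE:
  assumes "abelian_category C" "abelian_category D" "is_functor C D F" "is_functor D C G"
    and adj: "adjoint_pair C D F G"
  obtains \<phi> where "adjunction C D F G \<phi>"
proof -
  interpret C: abelian_category C by fact
  interpret D: abelian_category D by fact
  interpret F: functor_between C D F by unfold_locales fact
  interpret G: functor_between D C G by unfold_locales fact
  obtain \<phi> where \<phi>:
    "\<forall>A \<in> Obj C. \<forall>B \<in> Obj D. bij_betw (\<phi> A B) (Hom D (on_obj F A) B) (Hom C A (on_obj G B))"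
    "\<forall>A \<in> Obj C. \<forall>A' \<in> Obj C. \<forall>B \<in> Obj D. \<forall>a \<in> Hom C A' A. \<forall>h \<in> Hom D (on_obj F A) B.
      \<phi> A' B (h \<cdot>\<^bsub>D\<^esub> on_arr F a) = \<phi> A B h \<cdot>\<^bsub>C\<^esub> a"
    "\<forall>A \<in> Obj C. \<forall>B \<in> Obj D. \<forall>B' \<in> Obj D. \<forall>b \<in> Hom D B B'. \<forall>h \<in> Hom D (on_obj F A) B.
      \<phi> A B' (b \<cdot>\<^bsub>D\<^esub> h) = on_arr G b \<cdot>\<^bsub>C\<^esub> \<phi> A B h"
    using adj unfolding adjoint_pair_def by (elim exE conjE) (rule that)
  have "adjunction C D F G \<phi>"
  proof (unfold_locales, goal_cases)
    case 1
    then show ?case using \<phi>(1) by simp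
  next
    case (2 a A' A h B)
    then show ?case using \<phi>(2) C.Hom_obj[OF 2(1)] D.Hom_obj[OF 2(2)] by simp
  next
    case (3 A b B B' h)
    then show ?case using \<phi>(3) D.Hom_obj[OF 3(2)] by simp
  qed
  then show ?thesis using that by blast
qed

section \<open>Wide subcategories and recollements\<close>

text \<open>Every closure condition can be checked after applying \<open>F\<close>, which carries
  kernels, cokernels and hence short exact sequences to \<open>D\<close>, where \<open>W\<close> is
  wide.\<close>

lemma (in zero_functor_between) wide_preimage:
  assumes W: "wide_subcategory D W"
    and ker: "\<And>f k. is_kernel C f k \<Longrightarrow> is_kernel D (on_arr F f) (on_arr F k)"
    and coker: "\<And>f q. is_cokernel C f q \<Longrightarrow> is_cokernel D (on_arr F f) (on_arr F q)"
  shows "wide_subcategory C {A \<in> Obj C. on_obj F A \<in> W}"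
proof -
  have sub: "subcategory D W" using W by (simp add: wide_subcategory_def)
  obtain Z where "is_zero_obj C Z" using C.ex_zero_obj by blast
  then have "subcategory C {A \<in> Obj C. on_obj F A \<in> W}"
    using D.subcategory_iso[OF sub iso] D.subcategory_zero_obj[OF sub zero_obj]
    unfolding subcategory_def by (auto simp: is_zero_obj_def)
  moreover have "on_obj F (Cod C f) \<in> W" "Cod C f \<in> Obj C"
    if se: "short_exact C f g" "on_obj F (Dom C f) \<in> W" "on_obj F (Cod C g) \<in> W" for f g
  proof -
    have c: "is_cokernel C f g" "is_kernel C g f" using se by (auto simp: short_exact_def)
    note h = C.cokernel_hom[OF c(1)]
    have "short_exact D (on_arr F f) (on_arr F g)"
      using c ker coker by (simp add: short_exact_def)
    then show "on_obj F (Cod C f) \<in> W"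
      using W se HomD[OF hom[OF h(1)]] HomD[OF hom[OF h(2)]] unfolding wide_subcategory_def by metis
    show "Cod C f \<in> Obj C" using h C.Hom_obj by blast
  qed
  moreover have "on_obj F (Dom C k) \<in> W" "Dom C k \<in> Obj C"
    if "is_kernel C f k" "f \<in> Hom C A B" "on_obj F A \<in> W" "on_obj F B \<in> W" for f k A B
  proof -
    note h = C.kernel_hom(2)[OF that(1)]
    show "on_obj F (Dom C k) \<in> W"
      using W that(3,4) hom[OF that(2)] ker[OF that(1)] HomD[OF hom[OF h]]
      unfolding wide_subcategory_def by metis
    show "Dom C k \<in> Obj C" using h C.Hom_obj by blast
  qed
  moreover have "on_obj F (Cod C q) \<in> W" "Cod C q \<in> Obj C"
    if "is_cokernel C f q" "f \<in> Hom C A B" "on_obj F A \<in> W" "on_obj F B \<in> W" for f q A B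
  proof -
    note h = C.cokernel_hom(2)[OF that(1)]
    show "on_obj F (Cod C q) \<in> W"
      using W that(3,4) hom[OF that(2)] coker[OF that(1)] HomD[OF hom[OF h]]
      unfolding wide_subcategory_def by metis
    show "Cod C q \<in> Obj C" using h C.Hom_obj by blast
  qed
  ultimately show ?thesis unfolding wide_subcategory_def by blast
qed

text \<open>\<open>V\<close> and \<open>W\<close> each come with some zero object; a common one
  exists because each contains all of them.\<close>

lemma (in abelian_category) wide_subcategory_Int:
  assumes "wide_subcategory C V" "wide_subcategory C W"
  shows "wide_subcategory C (V \<inter> W)"
proof -
  have sub: "subcategory C V" "subcategory C W" using assms by (auto simp: wide_subcategory_def)
  obtain Z where Z: "is_zero_obj C Z" using ex_zero_obj by blast
  have "subcategory C (V \<inter> W)"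
    using sub Z subcategory_zero_obj[OF sub(1) Z] subcategory_zero_obj[OF sub(2) Z]
    unfolding subcategory_def by blast
  then show ?thesis
    using assms unfolding wide_subcategory_def by (intro conjI) blast+
qed

section \<open>Wide subcategories along a recollement\<close>

theorem theorem3p3:
  fixes \<Y> :: "('oY, 'mY, 'eY) acat_scheme"
    and \<X> :: "('oX, 'mX, 'eX) acat_scheme"
    and \<Z> :: "('oZ, 'mZ, 'eZ) acat_scheme"
    and i_ustar i_ushriek :: "('oX, 'mX, 'oY, 'mY) funct"
    and i_lstar :: "('oY, 'mY, 'oX, 'mX) funct"
    and j_ustar :: "('oX, 'mX, 'oZ, 'mZ) funct"
    and j_lshriek j_lstar :: "('oZ, 'mZ, 'oX, 'mX) funct"
    and W\<^sub>Y :: "'oY set" and W\<^sub>Z :: "'oZ set" and W\<^sub>X :: "'oX set"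
  assumes "length_abelian_category \<X>"
    and "length_abelian_category \<Y>"
    and "length_abelian_category \<Z>"
    and "recollement \<Y> \<X> \<Z> i_ustar i_lstar i_ushriek j_lshriek j_ustar j_lstar"
    and "subcategory \<Y> W\<^sub>Y"
    and "subcategory \<Z> W\<^sub>Z"
    and "W\<^sub>X = {X \<in> Obj \<X>. on_obj j_ustar X \<in> W\<^sub>Z \<and> on_obj i_ushriek X \<in> W\<^sub>Y}"
    and "exact_functor \<X> \<Y> i_ushriek"
  shows "wide_subcategory \<Y> W\<^sub>Y \<and> wide_subcategory \<Z> W\<^sub>Z \<longleftrightarrow> wide_subcategory \<X> W\<^sub>X"
proof -
  interpret R: recollement \<Y> \<X> \<Z> i_ustar i_lstar i_ushriek j_lshriek j_ustar j_lstar by fact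
  note ab = R.X.abelian_category_axioms R.Y.abelian_category_axioms R.Z.abelian_category_axioms
  obtain \<alpha> where "adjunction \<X> \<Y> i_ustar i_lstar \<alpha>"
    using adjunctionE ab R.functor_i_ustar R.functor_i_lstar R.adj_i_ustar_i_lstar by blast
  then interpret I1: adjunction \<X> \<Y> i_ustar i_lstar \<alpha> .
  obtain \<beta> where "adjunction \<Y> \<X> i_lstar i_ushriek \<beta>"
    using adjunctionE ab R.functor_i_lstar R.functor_i_ushriek R.adj_i_lstar_i_ushriek by blast
  then interpret I2: adjunction \<Y> \<X> i_lstar i_ushriek \<beta> .
  obtain \<gamma> where "adjunction \<Z> \<X> j_lshriek j_ustar \<gamma>"
    using adjunctionE ab R.functor_j_lshriek R.functor_j_ustar R.adj_j_lshriek_j_ustar by blast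
  then interpret J1: adjunction \<Z> \<X> j_lshriek j_ustar \<gamma> .
  obtain \<delta> where "adjunction \<X> \<Z> j_ustar j_lstar \<delta>"
    using adjunctionE ab R.functor_j_ustar R.functor_j_lstar R.adj_j_ustar_j_lstar by blast
  then interpret J2: adjunction \<X> \<Z> j_ustar j_lstar \<delta> .
  note subY = assms(5) and subZ = assms(6) and WX = assms(7) and exact = assms(8)
  \<comment> \<open>Exactness of \<open>i_ushriek\<close> enters here; that it preserves kernels
    comes from being a right adjoint.\<close>
  have i_ushriek_coker: "is_cokernel \<Y> (on_arr i_ushriek f) (on_arr i_ushriek q)"
    if "is_cokernel \<X> f q" for f q
    using I2.G.exact_cokernel[OF exact that] .
  \<comment> \<open>\<open>on_obj i_lstar Y\<close> lies in the essential image of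
    \<open>i_lstar\<close> via its identity, and that image is the kernel of
    \<open>j_ustar\<close>.\<close>
  have zero_ji: "is_zero_obj \<Z> (on_obj j_ustar (on_obj i_lstar Y))" if Y: "Y \<in> Obj \<Y>" for Y
  proof -
    have iY: "on_obj i_lstar Y \<in> Obj \<X>" using I1.G.obj Y by blast
    then have "isomorphic \<X> (on_obj i_lstar Y) (on_obj i_lstar Y)"
      unfolding R.X.isomorphic_iff using R.X.id_hom[OF iY] R.X.comp_id_left by blast
    then show ?thesis using R.image_eq_kernel Y iY by blast
  qed
  have zero_ij: "is_zero_obj \<Y> (on_obj i_ushriek (on_obj j_lstar Z))" if Z: "Z \<in> Obj \<Z>" for Z
  proof -
    define Y where "Y = on_obj i_ushriek (on_obj j_lstar Z)"
    have jZ: "on_obj j_lstar Z \<in> Obj \<X>" using J2.G.obj Z by blast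
    have Y: "Y \<in> Obj \<Y>" using I2.G.obj jZ by (simp add: Y_def)
    then have iY: "on_obj i_lstar Y \<in> Obj \<X>" using I1.G.obj by blast
    \<comment> \<open>Transposing along \<open>\<beta>\<close> and then \<open>\<delta>\<close>
      turns endomorphisms of \<open>Y\<close> into arrows to \<open>Z\<close> from
      \<open>j_ustar (i_lstar Y)\<close>, which is a zero object.\<close>
    have eq: "s = t" if s: "s \<in> Hom \<Y> Y Y" and t: "t \<in> Hom \<Y> Y Y" for s t
    proof -
      have s': "s \<in> Hom \<Y> Y (on_obj i_ushriek (on_obj j_lstar Z))"
        and t': "t \<in> Hom \<Y> Y (on_obj i_ushriek (on_obj j_lstar Z))"
        using s t by (simp_all only: Y_def)
      obtain s1 where s1: "s1 \<in> Hom \<X> (on_obj i_lstar Y) (on_obj j_lstar Z)"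
        "\<beta> Y (on_obj j_lstar Z) s1 = s" by (rule I2.phi_surj[OF jZ s'])
      obtain t1 where t1: "t1 \<in> Hom \<X> (on_obj i_lstar Y) (on_obj j_lstar Z)"
        "\<beta> Y (on_obj j_lstar Z) t1 = t" by (rule I2.phi_surj[OF jZ t'])
      obtain s2 where s2: "s2 \<in> Hom \<Z> (on_obj j_ustar (on_obj i_lstar Y)) Z"
        "\<delta> (on_obj i_lstar Y) Z s2 = s1" by (rule J2.phi_surj[OF Z s1(1)])
      obtain t2 where t2: "t2 \<in> Hom \<Z> (on_obj j_ustar (on_obj i_lstar Y)) Z"
        "\<delta> (on_obj i_lstar Y) Z t2 = t1" by (rule J2.phi_surj[OF Z t1(1)])
      have "s2 = t2" using s2(1) t2(1) zero_ji[OF Y] Z unfolding is_zero_obj_def by blast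
      then show ?thesis using s1 t1 s2 t2 by simp
    qed
    show ?thesis
      unfolding R.Y.is_zero_obj_iff Y_def[symmetric]
      using Y eq[OF R.Y.id_hom[OF Y] R.Y.zero_hom[OF Y Y]] by blast
  qed
  have WY: "W\<^sub>Y = {Y \<in> Obj \<Y>. on_obj i_lstar Y \<in> W\<^sub>X}"
  proof -
    \<comment> \<open>The \<open>j_ustar\<close> condition holds automatically, as
      \<open>W\<^sub>Z\<close> contains every zero object; the unit isomorphism settles the
      \<open>i_ushriek\<close> condition.\<close>
    have "on_obj i_lstar Y \<in> W\<^sub>X \<longleftrightarrow> Y \<in> W\<^sub>Y" if Y: "Y \<in> Obj \<Y>" for Y
      using R.Y.subcategory_iso[OF subY I2.unit_iso[OF R.ff_i_lstar Y]]
        R.Z.subcategory_zero_obj[OF subZ zero_ji[OF Y]] I1.G.obj[OF Y] WX by blast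
    then show ?thesis using subY unfolding subcategory_def by blast
  qed
  \<comment> \<open>With the roles exchanged: now the \<open>i_ushriek\<close> condition is
    automatic and the counit isomorphism settles the other.\<close>
  have j_lstar_WX: "on_obj j_lstar Z \<in> W\<^sub>X \<longleftrightarrow> Z \<in> W\<^sub>Z" if Z: "Z \<in> Obj \<Z>" for Z
    using R.Z.subcategory_iso[OF subZ J2.counit_iso[OF R.ff_j_lstar Z]]
      R.Y.subcategory_zero_obj[OF subY zero_ij[OF Z]] J2.G.obj[OF Z] WX by blast
  show ?thesis
  proof
    assume "wide_subcategory \<Y> W\<^sub>Y \<and> wide_subcategory \<Z> W\<^sub>Z"
    then have "wide_subcategory \<X> {X \<in> Obj \<X>. on_obj i_ushriek X \<in> W\<^sub>Y}"
      "wide_subcategory \<X> {X \<in> Obj \<X>. on_obj j_ustar X \<in> W\<^sub>Z}"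
      using I2.G.wide_preimage I2.right_kernel i_ushriek_coker
        J1.G.wide_preimage J1.right_kernel J2.left_cokernel by blast+
    then have "wide_subcategory \<X>
        ({X \<in> Obj \<X>. on_obj i_ushriek X \<in> W\<^sub>Y} \<inter> {X \<in> Obj \<X>. on_obj j_ustar X \<in> W\<^sub>Z})"
      using R.X.wide_subcategory_Int by blast
    moreover have "W\<^sub>X = {X \<in> Obj \<X>. on_obj i_ushriek X \<in> W\<^sub>Y} \<inter> {X \<in> Obj \<X>. on_obj j_ustar X \<in> W\<^sub>Z}"
      using WX by blast
    ultimately show "wide_subcategory \<X> W\<^sub>X" by simp
  next
    assume wX: "wide_subcategory \<X> W\<^sub>X"
    have "wide_subcategory \<Y> W\<^sub>Y"
      using I1.G.wide_preimage[OF wX] I1.right_kernel I2.left_cokernel WY by simp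
    moreover have "Cod \<Z> f \<in> W\<^sub>Z"
      if se: "short_exact \<Z> f g" and W: "Dom \<Z> f \<in> W\<^sub>Z" "Cod \<Z> g \<in> W\<^sub>Z" for f g
    proof -
      have ker: "is_kernel \<Z> g f" and coker: "is_cokernel \<Z> f g"
        using se by (auto simp: short_exact_def)
      note f = R.Z.cokernel_hom(1)[OF coker]
      note jf = J2.G.hom[OF f]
      have B: "Cod \<Z> f \<in> Obj \<Z>" using R.Z.Hom_obj[OF f] by blast
      \<comment> \<open>\<open>on_arr j_lstar g\<close> may fail to be a cokernel, so
        \<open>q\<close> takes its place. As \<open>on_arr j_lstar f\<close> is still a kernel, it
        forms a short exact sequence with \<open>q\<close>.\<close>
      obtain q where q: "is_cokernel \<X> (on_arr j_lstar f) q" using R.X.ex_cokernel HomD(1)[OF jf] by blast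
      have jse: "short_exact \<X> (on_arr j_lstar f) q"
        using R.X.kernel_cokernel_of_mono_kernel[OF J2.right_kernel[OF ker] q] .
      have Q: "Cod \<X> q \<in> Obj \<X>" using R.X.Hom_obj[OF R.X.cokernel_hom(2)[OF q]] by blast
      have "on_obj j_ustar (Cod \<X> q) \<in> W\<^sub>Z"
        using R.Z.subcategory_iso[OF subZ J2.cokernel_via_right_adjoint[OF R.ff_j_lstar coker q]] W by blast
      moreover have "on_obj i_ushriek (Cod \<X> q) \<in> W\<^sub>Y"
      proof -
        have "Cod \<Y> (on_arr i_ushriek (on_arr j_lstar f)) = on_obj i_ushriek (on_obj j_lstar (Cod \<Z> f))"
          "Cod \<Y> (on_arr i_ushriek q) = on_obj i_ushriek (Cod \<X> q)"
          using HomD(3)[OF I2.G.hom[OF jf]] HomD(3)[OF I2.G.hom[OF R.X.cokernel_hom(2)[OF q]]] by auto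
        then show ?thesis
          using R.Y.cokernel_zero_obj[OF i_ushriek_coker[OF q]] zero_ij[OF B]
            R.Y.subcategory_zero_obj[OF subY] by metis
      qed
      ultimately have "Cod \<X> q \<in> W\<^sub>X" using WX Q by blast
      moreover have "Dom \<X> (on_arr j_lstar f) \<in> W\<^sub>X"
        using HomD(2)[OF jf] j_lstar_WX W R.Z.Hom_obj[OF f] by simp
      ultimately have "Cod \<X> (on_arr j_lstar f) \<in> W\<^sub>X"
        using wX jse unfolding wide_subcategory_def by blast
      then show ?thesis using HomD(3)[OF jf] j_lstar_WX B by simp
    qed
    moreover have "Dom \<Z> k \<in> W\<^sub>Z"
      if W: "A \<in> W\<^sub>Z" "B \<in> W\<^sub>Z" and f: "f \<in> Hom \<Z> A B" and k: "is_kernel \<Z> f k" for A B f k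
    proof -
      note kh = R.Z.kernel_hom(2)[OF k]
      have "on_obj j_lstar A \<in> W\<^sub>X" "on_obj j_lstar B \<in> W\<^sub>X" using W j_lstar_WX R.Z.Hom_obj[OF f] by auto
      then have "Dom \<X> (on_arr j_lstar k) \<in> W\<^sub>X"
        using wX J2.G.hom[OF f] J2.right_kernel[OF k] unfolding wide_subcategory_def by blast
      then show ?thesis using HomD(2)[OF J2.G.hom[OF kh]] j_lstar_WX R.Z.Hom_obj[OF kh] by simp
    qed
    moreover have "Cod \<Z> g \<in> W\<^sub>Z"
      if W: "A \<in> W\<^sub>Z" "B \<in> W\<^sub>Z" and f: "f \<in> Hom \<Z> A B" and g: "is_cokernel \<Z> f g" for A B f g
    proof -
      note jf = J2.G.hom[OF f]
      \<comment> \<open>Wideness of \<open>W\<^sub>X\<close> applies to \<open>q\<close> directly;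
        applying \<open>j_ustar\<close> to its codomain then returns the cokernel of
        \<open>f\<close>.\<close>
      obtain q where q: "is_cokernel \<X> (on_arr j_lstar f) q" using R.X.ex_cokernel HomD(1)[OF jf] by blast
      have "on_obj j_lstar A \<in> W\<^sub>X" "on_obj j_lstar B \<in> W\<^sub>X" using W j_lstar_WX R.Z.Hom_obj[OF f] by auto
      then have "Cod \<X> q \<in> W\<^sub>X"
        using wX jf q unfolding wide_subcategory_def by blast
      then have "on_obj j_ustar (Cod \<X> q) \<in> W\<^sub>Z" using WX by blast
      then show ?thesis
        using R.Z.subcategory_iso[OF subZ J2.cokernel_via_right_adjoint[OF R.ff_j_lstar g q]] by blast
    qed
    ultimately show "wide_subcategory \<Y> W\<^sub>Y \<and> wide_subcategory \<Z> W\<^sub>Z"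
      using subZ unfolding wide_subcategory_def[of \<Z>] by blast
  qed
qed

end
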